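(* Let DDPDOF be solvable. Let the pair $(A,[\,B\ \ H\,])$ be reachable and let the pair $\left(\begin{bmatrix}C\\ E\end{bmatrix},A\right)$ be observable. Let $\sigma^\ast=\sigma_{\rm fixed}(\mathcal{V}_m\cap\mathcal{S}_M,\mathcal{V}_m)$. Then there exists $K\in\mathbb{R}^{m\times p}$ such that for every $(A,H,C,G_y)$-input containing subspace $\mathcal{S}$ with $\mathcal{V}_m\cap\mathcal{S}_M\subseteq\mathcal{S}\subseteq\mathcal{S}_M$, the triple $(\mathcal{S},\mathcal{S}+\mathcal{V}_m;K)$ is a solution triple and $\sigma_{\rm fixed}(\mathcal{S},\mathcal{S}+\mathcal{V}_m)=\sigma^\ast$.
   Context: Plant: $\mathcal{D}x=Ax+Bu+Hw$, $y=Cx+D_yu+G_yw$, $z=Ex+D_zu+G_zw$, with real matrices, $x\in\mathcal{X}=\mathbb{R}^n$, control $u\in\mathcal{U}=\mathbb{R}^m$, disturbance $w\in\mathcal{W}=\mathbb{R}^q$, measurement $y\in\mathcal{Y}=\mathbb{R}^p$, to-be-controlled output $z\in\mathcal{Z}=\mathbb{R}^r$ ($\mathcal{D}$ is the time derivative or the unit shift). $0_{\mathcal{Z}}$ is the zero subspace of $\mathcal{Z}$. Controller: $\mathcal{D}p=A_cp+B_cy$, $u=C_cp+D_cy$, $p\in\mathbb{R}^s$. The interconnection is well posed if $I-D_yD_c$ is nonsingular; with $W=(I-D_yD_c)^{-1}$ the closed loop is $\mathcal{D}\hat x=\widehat A\hat x+\widehat Hw$, $z=\widehat C\hat x+\widehat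 Gw$, where $\hat x=\begin{bmatrix}x\\ p\end{bmatrix}$, $\widehat A=\begin{bmatrix}A+BD_cWC&BC_c+BD_cWD_yC_c\\ B_cWC&A_c+B_cWD_yC_c\end{bmatrix}$, $\widehat H=\begin{bmatrix}H+BD_cWG_y\\ B_cWG_y\end{bmatrix}$, $\widehat C=[\,E+D_zD_cWC\ \ \ D_zC_c+D_zD_cWD_yC_c\,]$, $\widehat G=G_z+D_zD_cWG_y$. A controller solves DDPDOF (disturbance decoupling problem by dynamic output feedback) if the interconnection is well posed and $\widehat C(\lambda I-\widehat A)^{-1}\widehat H+\widehat G=0$ identically in $\lambda$; DDPDOF is solvable if such a controller exists. Geometric notions, for a generic quadruple $(A,B,C,D)$ with state space $\mathcal{X}$, input space $\mathcal{U}$, output space $\mathcal{Y}$ (applied with other matrices and the corresponding input/output spaces). $\langle A\,|\,\mathcal{J}\rangle$ is the smallest $A$-invariant subspace containing $\mathcal{J}$; $\langle\mathcal{J}\,|\,A\rangle$ is the largest $A$-invariant subspace contained in $\mathcal{J}$. $\mathcal{V}$ is $(A,B,C,D)$-output nulling if there is $F$ (a friend of $\mathcal{V}$) with $\begin{bmatrix}A+BF\\ C+DF\end{bmatrix}\mathcal{V}\subseteq\mathcal{V}\oplus0_{\mathcal{Y}}$; the largest such subspace is $\mathcal{V}^\star_{(A,B,C,D)}$. $\mathcal{R}_{\mathcal{V}}=\langle A+BF\,|\,\mathcal{V}\cap B\ker D\rangle$ for any friend $F$, and $\mathcal{R}^\star_{(A,B,C,D)}=\mathcal{R}_{\mathcal{V}^\star_{(A,B,C,D)}}$.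 $\mathcal{S}$ is $(A,B,C,D)$-input containing if there is $G$ (a friend of $\mathcal{S}$) with $[\,A+GC\ \ B+GD\,](\mathcal{S}\oplus\mathcal{U})\subseteq\mathcal{S}$; the smallest such subspace is $\mathcal{S}^\star_{(A,B,C,D)}$. $\mathcal{Q}_{\mathcal{S}}=\langle\mathcal{S}+C^{-1}\operatorname{im}D\,|\,A+GC\rangle$ for any friend $G$, and $\mathcal{Q}^\star_{(A,B,C,D)}=\mathcal{Q}_{\mathcal{S}^\star_{(A,B,C,D)}}$. $\mathcal{V}_m=\mathcal{R}^\star_{(A,[B\ H],E,[D_z\ G_z])}$ and $\mathcal{S}_M=\mathcal{Q}^\star_{\left(A,H,\begin{bmatrix}C\\ E\end{bmatrix},\begin{bmatrix}G_y\\ G_z\end{bmatrix}\right)}$. Solution triple: $(\mathcal{S},\mathcal{V};K)$ with $\mathcal{V}$ $(A,B,E,D_z)$-output nulling, $\mathcal{S}$ $(A,H,C,G_y)$-input containing, $K\in\mathbb{R}^{m\times p}$, such that (i) $\operatorname{im}\begin{bmatrix}H\\ G_z\end{bmatrix}\subseteq(\mathcal{V}\oplus 0_{\mathcal{Z}})+\operatorname{im}\begin{bmatrix}B\\ D_z\end{bmatrix}$; (ii) $\ker[\,E\ \ G_z\,]\supseteq(\mathcal{S}\oplus\mathcal{W})\cap\ker[\,C\ \ G_y\,]$; (iii) $\mathcal{S}\subseteq\mathcal{V}$; (iv) $I+KD_y$ is nonsingular and $\begin{bmatrix}A+BKC&H+BKG_y\\ E+D_zKC&G_z+D_zKG_y\end{bmatrix}(\mathcal{S}\oplus\mathcal{W})\subseteq\mathcal{V}\oplus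 0_{\mathcal{Z}}$. Fixed poles. Spectra are multisets (eigenvalues counted with multiplicity), $\uplus$ is union with common elements repeated, and $\sigma(T\,|\,\mathcal{J}_2/\mathcal{J}_1)$ is the spectrum of the map induced by $T$ on $\mathcal{J}_2/\mathcal{J}_1$. For $\mathcal{V}$ $(A,B,E,D_z)$-output nulling with friend $F$: $\sigma_{\rm fixed}(\mathcal{V})=\sigma\bigl(A+BF\,|\,\mathcal{X}/(\mathcal{V}+\langle A|\operatorname{im}B\rangle)\bigr)\uplus\sigma(A+BF\,|\,\mathcal{V}/\mathcal{R}_{\mathcal{V}})$. For $\mathcal{S}$ $(A,H,C,G_y)$-input containing with friend $G$: $\sigma_{\rm fixed}(\mathcal{S})=\sigma(A+GC\,|\,\mathcal{Q}_{\mathcal{S}}/\mathcal{S})\uplus\sigma(A+GC\,|\,\mathcal{S}\cap\langle\ker C|A\rangle)$. These do not depend on the friends. $\sigma_{\rm fixed}(\mathcal{S},\mathcal{V})=\sigma_{\rm fixed}(\mathcal{V})\uplus\sigma_{\rm fixed}(\mathcal{S})$. *)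

theory Defs
  imports
    "Jordan_Normal_Form.Char_Poly"
    "HOL-Analysis.Analysis"
    "HOL-Library.Set_Algebras"
begin

hide_const (open) Matrix.mat Matrix.vec Matrix.row Matrix.col Matrix.transpose_mat
  Determinant.det Matrix.vec_index
no_notation Matrix.vec_index (infixl "$" 100)

text \<open>
  An \<open>n \<times> m\<close> matrix has type \<open>real^'m^'n\<close>, and \<open>\<real>\<^sup>n \<oplus> \<real>\<^sup>m\<close> is \<open>real^('n + 'm)\<close>.
  Sums of subspaces are pointwise sums of sets (\<^theory>\<open>HOL-Library.Set_Algebras\<close>).
\<close>

section \<open>Block matrices and direct sums\<close>

text \<open>Vertical concatenation; it serves for column vectors and (rowwise) for matrices.\<close>

definition vstack :: "'b^'n \<Rightarrow> 'b^'p \<Rightarrow> 'b^('n + 'p)" where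
  "vstack M N = (\<chi> i. case i of Inl a \<Rightarrow> M $ a | Inr b \<Rightarrow> N $ b)"

definition hstack :: "'a^'m^'n \<Rightarrow> 'a^'q^'n \<Rightarrow> 'a^('m + 'q)^'n" where
  "hstack M N = (\<chi> i. vstack (M $ i) (N $ i))"

definition dsum :: "(real^'n) set \<Rightarrow> (real^'p) set \<Rightarrow> (real^('n + 'p)) set" where
  "dsum V W = {vstack v w | v w. v \<in> V \<and> w \<in> W}"

definition ker :: "real^'m^'n \<Rightarrow> (real^'m) set" where
  "ker M = {x. M *v x = 0}"

definition im :: "real^'m^'n \<Rightarrow> (real^'n) set" where
  "im M = range ((*v) M)"

section \<open>Invariant, output nulling and input containing subspaces\<close>

definition invariant_subspace :: "real^'n^'n \<Rightarrow> (real^'n) set \<Rightarrow> bool" where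
  "invariant_subspace A J \<longleftrightarrow> subspace J \<and> (*v) A ` J \<subseteq> J"

definition least_invariant :: "real^'n^'n \<Rightarrow> (real^'n) set \<Rightarrow> (real^'n) set" where
  "least_invariant A J = (LEAST L. invariant_subspace A L \<and> J \<subseteq> L)"

definition greatest_invariant :: "(real^'n) set \<Rightarrow> real^'n^'n \<Rightarrow> (real^'n) set" where
  "greatest_invariant J A = (GREATEST L. invariant_subspace A L \<and> L \<subseteq> J)"

definition on_friend ::
  "real^'n^'n \<Rightarrow> real^'m^'n \<Rightarrow> real^'n^'p \<Rightarrow> real^'m^'p \<Rightarrow> (real^'n) set \<Rightarrow> real^'n^'m \<Rightarrow> bool" where
  "on_friend A B C D V F \<longleftrightarrow>
     (*v) (vstack (A + B ** F) (C + D ** F)) ` V \<subseteq> dsum V {0}"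

definition output_nulling ::
  "real^'n^'n \<Rightarrow> real^'m^'n \<Rightarrow> real^'n^'p \<Rightarrow> real^'m^'p \<Rightarrow> (real^'n) set \<Rightarrow> bool" where
  "output_nulling A B C D V \<longleftrightarrow> subspace V \<and> (\<exists>F. on_friend A B C D V F)"

definition V_star ::
  "real^'n^'n \<Rightarrow> real^'m^'n \<Rightarrow> real^'n^'p \<Rightarrow> real^'m^'p \<Rightarrow> (real^'n) set" where
  "V_star A B C D = (GREATEST V. output_nulling A B C D V)"

text \<open>
  The subspaces \<open>\<R>\<^sub>V\<close>, \<open>\<Q>\<^sub>S\<close> and the fixed spectra below do not depend on the friend they are
  computed with; an arbitrary friend is chosen.
\<close>

definition R_of ::
  "real^'n^'n \<Rightarrow> real^'m^'n \<Rightarrow> real^'n^'p \<Rightarrow> real^'m^'p \<Rightarrow> (real^'n) set \<Rightarrow> (real^'n) set" where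
  "R_of A B C D V =
     (let F = (SOME F. on_friend A B C D V F)
      in least_invariant (A + B ** F) (V \<inter> (*v) B ` ker D))"

definition R_star ::
  "real^'n^'n \<Rightarrow> real^'m^'n \<Rightarrow> real^'n^'p \<Rightarrow> real^'m^'p \<Rightarrow> (real^'n) set" where
  "R_star A B C D = R_of A B C D (V_star A B C D)"

definition ic_friend ::
  "real^'n^'n \<Rightarrow> real^'m^'n \<Rightarrow> real^'n^'p \<Rightarrow> real^'m^'p \<Rightarrow> (real^'n) set \<Rightarrow> real^'p^'n \<Rightarrow> bool" where
  "ic_friend A B C D S G \<longleftrightarrow>
     (*v) (hstack (A + G ** C) (B + G ** D)) ` dsum S UNIV \<subseteq> S"

definition input_containing ::
  "real^'n^'n \<Rightarrow> real^'m^'n \<Rightarrow> real^'n^'p \<Rightarrow> real^'m^'p \<Rightarrow> (real^'n) set \<Rightarrow> bool" where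
  "input_containing A B C D S \<longleftrightarrow> subspace S \<and> (\<exists>G. ic_friend A B C D S G)"

definition S_star ::
  "real^'n^'n \<Rightarrow> real^'m^'n \<Rightarrow> real^'n^'p \<Rightarrow> real^'m^'p \<Rightarrow> (real^'n) set" where
  "S_star A B C D = (LEAST S. input_containing A B C D S)"

definition Q_of ::
  "real^'n^'n \<Rightarrow> real^'m^'n \<Rightarrow> real^'n^'p \<Rightarrow> real^'m^'p \<Rightarrow> (real^'n) set \<Rightarrow> (real^'n) set" where
  "Q_of A B C D S =
     (let G = (SOME G. ic_friend A B C D S G)
      in greatest_invariant (S + (*v) C -` im D) (A + G ** C))"

definition Q_star ::
  "real^'n^'n \<Rightarrow> real^'m^'n \<Rightarrow> real^'n^'p \<Rightarrow> real^'m^'p \<Rightarrow> (real^'n) set" where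
  "Q_star A B C D = Q_of A B C D (S_star A B C D)"

definition reachable :: "real^'n^'n \<Rightarrow> real^'m^'n \<Rightarrow> bool" where
  "reachable A B \<longleftrightarrow> least_invariant A (im B) = UNIV"

definition observable :: "real^'n^'p \<Rightarrow> real^'n^'n \<Rightarrow> bool" where
  "observable C A \<longleftrightarrow> greatest_invariant (ker C) A = {0}"

section \<open>Spectra of induced maps\<close>

text \<open>
  For \<open>T\<close>-invariant subspaces \<open>J\<^sub>1 \<subseteq> J\<^sub>2\<close>: the classes of the vectors \<open>bs\<close> form a basis of
  \<open>J\<^sub>2/J\<^sub>1\<close>, and \<open>M\<close> is the matrix with respect to it of the map induced by \<open>T\<close>.  The order of \<open>M\<close>
  varies with the subspaces, hence the carrier-based matrix type \<^typ>\<open>real mat\<close>.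
\<close>

definition induced_matrix ::
  "real^'n^'n \<Rightarrow> (real^'n) set \<Rightarrow> (real^'n) set \<Rightarrow> (real^'n) list \<Rightarrow> real mat \<Rightarrow> bool" where
  "induced_matrix T J2 J1 bs M \<longleftrightarrow>
     set bs \<subseteq> J2 \<and>
     (\<forall>c. (\<Sum>i<length bs. c i *\<^sub>R bs ! i) \<in> J1 \<longrightarrow> (\<forall>i<length bs. c i = (0::real))) \<and>
     (\<forall>x\<in>J2. \<exists>c. x - (\<Sum>i<length bs. c i *\<^sub>R bs ! i) \<in> J1) \<and>
     M \<in> carrier_mat (length bs) (length bs) \<and>
     (\<forall>j<length bs. T *v (bs ! j) - (\<Sum>i<length bs. (M $$ (i, j)) *\<^sub>R bs ! i) \<in> J1)"

definition spectrum_on ::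
  "real^'n^'n \<Rightarrow> (real^'n) set \<Rightarrow> (real^'n) set \<Rightarrow> complex multiset" where
  "spectrum_on T J2 J1 =
     proots (map_poly complex_of_real (char_poly (SOME M. \<exists>bs. induced_matrix T J2 J1 bs M)))"

definition fixed_on ::
  "real^'n^'n \<Rightarrow> real^'m^'n \<Rightarrow> real^'n^'p \<Rightarrow> real^'m^'p \<Rightarrow> (real^'n) set \<Rightarrow> complex multiset" where
  "fixed_on A B C D V =
     (let F = (SOME F. on_friend A B C D V F)
      in spectrum_on (A + B ** F) UNIV (V + least_invariant A (im B))
         + spectrum_on (A + B ** F) V (R_of A B C D V))"

definition fixed_ic ::
  "real^'n^'n \<Rightarrow> real^'m^'n \<Rightarrow> real^'n^'p \<Rightarrow> real^'m^'p \<Rightarrow> (real^'n) set \<Rightarrow> complex multiset" where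
  "fixed_ic A B C D S =
     (let G = (SOME G. ic_friend A B C D S G)
      in spectrum_on (A + G ** C) (Q_of A B C D S) S
         + spectrum_on (A + G ** C) (S \<inter> greatest_invariant (ker C) A) {0})"

section \<open>The disturbance decoupling problem\<close>

text \<open>
  The plant is \<open>Dx = A x + B u + H w\<close>, \<open>y = C x + D\<^sub>y u + G\<^sub>y w\<close>, \<open>z = E x + D\<^sub>z u + G\<^sub>z w\<close>.
\<close>

abbreviation cmatrix :: "real^'m^'n \<Rightarrow> complex^'m^'n" where
  "cmatrix M \<equiv> map_matrix complex_of_real M"

text \<open>
  The rational matrix \<open>C (\<lambda> I - A)\<^sup>-\<^sup>1 H + G\<close> vanishes identically, that is, wherever it is defined.
\<close>

definition zero_transfer ::
  "real^'n^'n \<Rightarrow> real^'q^'n \<Rightarrow> real^'n^'r \<Rightarrow> real^'q^'r \<Rightarrow> bool" where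
  "zero_transfer A H C G \<longleftrightarrow>
     (\<forall>l::complex. invertible (mat l - cmatrix A) \<longrightarrow>
        cmatrix C ** matrix_inv (mat l - cmatrix A) ** cmatrix H + cmatrix G = 0)"

definition solves_DDPDOF ::
  "real^'n^'n \<Rightarrow> real^'m^'n \<Rightarrow> real^'q^'n \<Rightarrow>
   real^'n^'p \<Rightarrow> real^'m^'p \<Rightarrow> real^'q^'p \<Rightarrow>
   real^'n^'r \<Rightarrow> real^'m^'r \<Rightarrow> real^'q^'r \<Rightarrow>
   real^'s^'s \<Rightarrow> real^'p^'s \<Rightarrow> real^'s^'m \<Rightarrow> real^'p^'m \<Rightarrow> bool" where
  "solves_DDPDOF A B H C Dy Gy E Dz Gz Ac Bc Cc Dc \<longleftrightarrow>
     invertible (mat 1 - Dy ** Dc) \<and>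
     (let W = matrix_inv (mat 1 - Dy ** Dc);
          Ahat = vstack
            (hstack (A + B ** Dc ** W ** C) (B ** Cc + B ** Dc ** W ** Dy ** Cc))
            (hstack (Bc ** W ** C) (Ac + Bc ** W ** Dy ** Cc));
          Hhat = vstack (H + B ** Dc ** W ** Gy) (Bc ** W ** Gy);
          Chat = hstack (E + Dz ** Dc ** W ** C) (Dz ** Cc + Dz ** Dc ** W ** Dy ** Cc);
          Ghat = Gz + Dz ** Dc ** W ** Gy
      in zero_transfer Ahat Hhat Chat Ghat)"

text \<open>Index types are nonempty, so the controllers \<open>u = D\<^sub>c y\<close> of order \<open>s = 0\<close> are treated apart.\<close>

definition static_solves_DDPDOF ::
  "real^'n^'n \<Rightarrow> real^'m^'n \<Rightarrow> real^'q^'n \<Rightarrow>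
   real^'n^'p \<Rightarrow> real^'m^'p \<Rightarrow> real^'q^'p \<Rightarrow>
   real^'n^'r \<Rightarrow> real^'m^'r \<Rightarrow> real^'q^'r \<Rightarrow> real^'p^'m \<Rightarrow> bool" where
  "static_solves_DDPDOF A B H C Dy Gy E Dz Gz Dc \<longleftrightarrow>
     invertible (mat 1 - Dy ** Dc) \<and>
     (let W = matrix_inv (mat 1 - Dy ** Dc)
      in zero_transfer (A + B ** Dc ** W ** C) (H + B ** Dc ** W ** Gy)
           (E + Dz ** Dc ** W ** C) (Gz + Dz ** Dc ** W ** Gy))"

text \<open>
  Solvability by a controller of order 0 or \<open>CARD('s)\<close>.  As a premise with free \<open>'s\<close> it
  expresses the existence of a controller of some order, since the theorem is then
  universally quantified over \<open>'s\<close>.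
\<close>

definition DDPDOF_solvable ::
  "'s::finite itself \<Rightarrow> real^'n^'n \<Rightarrow> real^'m^'n \<Rightarrow> real^'q^'n \<Rightarrow>
   real^'n^'p \<Rightarrow> real^'m^'p \<Rightarrow> real^'q^'p \<Rightarrow>
   real^'n^'r \<Rightarrow> real^'m^'r \<Rightarrow> real^'q^'r \<Rightarrow> bool" where
  "DDPDOF_solvable _ A B H C Dy Gy E Dz Gz \<longleftrightarrow>
     (\<exists>Dc. static_solves_DDPDOF A B H C Dy Gy E Dz Gz Dc) \<or>
     (\<exists>(Ac :: real^'s^'s) Bc Cc Dc. solves_DDPDOF A B H C Dy Gy E Dz Gz Ac Bc Cc Dc)"

definition V_m ::
  "real^'n^'n \<Rightarrow> real^'m^'n \<Rightarrow> real^'q^'n \<Rightarrow> real^'n^'r \<Rightarrow> real^'m^'r \<Rightarrow> real^'q^'r \<Rightarrow>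
   (real^'n) set" where
  "V_m A B H E Dz Gz = R_star A (hstack B H) E (hstack Dz Gz)"

definition S_M ::
  "real^'n^'n \<Rightarrow> real^'q^'n \<Rightarrow> real^'n^'p \<Rightarrow> real^'q^'p \<Rightarrow> real^'n^'r \<Rightarrow> real^'q^'r \<Rightarrow>
   (real^'n) set" where
  "S_M A H C Gy E Gz = Q_star A H (vstack C E) (vstack Gy Gz)"

definition solution_triple ::
  "real^'n^'n \<Rightarrow> real^'m^'n \<Rightarrow> real^'q^'n \<Rightarrow>
   real^'n^'p \<Rightarrow> real^'m^'p \<Rightarrow> real^'q^'p \<Rightarrow>
   real^'n^'r \<Rightarrow> real^'m^'r \<Rightarrow> real^'q^'r \<Rightarrow>
   (real^'n) set \<Rightarrow> (real^'n) set \<Rightarrow> real^'p^'m \<Rightarrow> bool" where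
  "solution_triple A B H C Dy Gy E Dz Gz S V K \<longleftrightarrow>
     output_nulling A B E Dz V \<and>
     input_containing A H C Gy S \<and>
     im (vstack H Gz) \<subseteq> dsum V {0} + im (vstack B Dz) \<and>
     dsum S UNIV \<inter> ker (hstack C Gy) \<subseteq> ker (hstack E Gz) \<and>
     S \<subseteq> V \<and>
     invertible (mat 1 + K ** Dy) \<and>
     (*v) (vstack (hstack (A + B ** K ** C) (H + B ** K ** Gy))
                  (hstack (E + Dz ** K ** C) (Gz + Dz ** K ** Gy))) ` dsum S UNIV
       \<subseteq> dsum V {0}"

definition sigma_fixed ::
  "real^'n^'n \<Rightarrow> real^'m^'n \<Rightarrow> real^'q^'n \<Rightarrow> real^'n^'p \<Rightarrow> real^'q^'p \<Rightarrow>
   real^'n^'r \<Rightarrow> real^'m^'r \<Rightarrow> (real^'n) set \<Rightarrow> (real^'n) set \<Rightarrow> complex multiset" where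
  "sigma_fixed A B H C Gy E Dz S V = fixed_on A B E Dz V + fixed_ic A H C Gy S"

end

theory Submission
  imports Defs
begin

text \<open>
  A decoupling controller yields an invariant subspace \<open>U\<close> of the closed loop between
  the disturbance image and the output kernel; its section \<open>S\<^sub>0\<close> and projection \<open>V\<^sub>0\<close> form,
  with \<open>K = D\<^sub>c W\<close>, a solution triple.  Let \<open>S\<^sup>*\<close> be the least \<open>(A, H, C, G\<^sub>y)\<close>-input containing subspace.  Then
  \<open>S\<^sup>* \<subseteq> S\<^sub>0 \<subseteq> V\<^sub>0\<close>, and since \<open>V\<^sub>m\<close> is self-bounded, the output feedback \<open>K\<close> maps \<open>S\<^sup>* \<oplus> \<W>\<close> even into
  \<open>V\<^sub>m \<oplus> 0\<close>.  Every \<open>S\<close> of the family is self-hidden: its elements agree with elements of \<open>S\<^sup>*\<close>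
  up to vectors that, with a suitable disturbance, are invisible in both \<open>y\<close> and \<open>z\<close>.  So the
  same \<open>K\<close> maps \<open>S \<oplus> \<W>\<close> into \<open>(S + V\<^sub>m) \<oplus> 0\<close>.

  Reachability and observability make two of the four fixed spectra empty.  Self-boundedness
  and self-hiddenness make \<open>\<R>\<close> and \<open>\<Q>\<close> constant on the family, so passing from
  \<open>V\<^sub>m \<inter> S\<^sub>M\<close> to \<open>S\<close> removes \<open>\<sigma>(A + G C | S / (V\<^sub>m \<inter> S\<^sub>M))\<close> and adds \<open>\<sigma>(A + B F | (S + V\<^sub>m) / V\<^sub>m)\<close>.
  These agree because \<open>A + B F\<close> and \<open>A + G C\<close> coincide on \<open>S\<close> modulo \<open>V\<^sub>m\<close>.
\<close>

section \<open>Block matrices\<close>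

lemma vstack_eq_iff [simp]: "vstack a b = vstack c d \<longleftrightarrow> a = c \<and> b = d"
  by (auto simp: vstack_def vec_eq_iff split: sum.splits)

lemma vstack_0 [simp]: "vstack 0 0 = 0"
  by (simp add: vstack_def vec_eq_iff split: sum.splits)

lemma vstack_eq_0_iff [simp]: "vstack a b = 0 \<longleftrightarrow> a = 0 \<and> b = 0"
  using vstack_eq_iff[of a b 0 0] by simp

lemma vstack_add: "vstack a b + vstack c d = vstack (a + c) (b + d)"
  by (simp add: vstack_def vec_eq_iff split: sum.splits)

lemma vstack_scaleR: "r *\<^sub>R vstack a b = vstack (r *\<^sub>R a) (r *\<^sub>R b)"
  by (simp add: vstack_def vec_eq_iff split: sum.splits)

lemma ex_vstack: "\<exists>a b. x = vstack a b"
  by (rule exI[of _ "\<chi> i. x $ Inl i"], rule exI[of _ "\<chi> i. x $ Inr i"])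
    (simp add: vstack_def vec_eq_iff split: sum.splits)

lemma vstack_mult_vec [simp]: "vstack M N *v x = vstack (M *v x) (N *v x)"
  by (simp add: vstack_def vec_eq_iff matrix_vector_mult_def split: sum.splits)

lemma hstack_mult_vec [simp]: "hstack M N *v vstack x y = M *v x + N *v y"
proof -
  have "(\<Sum>j\<in>UNIV. hstack M N $ i $ j * vstack x y $ j)
      = (\<Sum>j\<in>UNIV. M $ i $ j * x $ j) + (\<Sum>j\<in>UNIV. N $ i $ j * y $ j)" for i
    by (simp add: hstack_def vstack_def sum.Plus flip: UNIV_Plus_UNIV)
  then show ?thesis
    by (simp add: vec_eq_iff matrix_vector_mult_def)
qed

lemma vstack_in_dsum_iff [simp]: "vstack v w \<in> dsum V W \<longleftrightarrow> v \<in> V \<and> w \<in> W"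
  by (auto simp: dsum_def)

lemma matrix_vector_mult_uminus_right: "M *v (- x) = - (M *v x)"
  for M :: "real^'a^'b"
  using matrix_vector_mult_diff_distrib[of M 0 x] by simp

lemmas mat_simps = matrix_vector_mult_add_rdistrib matrix_vector_right_distrib
  matrix_vector_mult_diff_distrib matrix_vector_mult_diff_rdistrib
  matrix_vector_mult_uminus_right matrix_vector_mul_assoc[symmetric]

section \<open>Friends\<close>

lemma subspace_plus:
  fixes S T :: "'a::real_vector set"
  assumes "subspace S" "subspace T"
  shows "subspace (S + T)"
proof -
  have "S + T = {x + y |x y. x \<in> S \<and> y \<in> T}"
    unfolding set_plus_def by blast
  then show ?thesis
    using subspace_sums[OF assms] by simp
qed

lemma subset_set_plus:
  fixes S T :: "'a::real_vector set"
  assumes "subspace S" "subspace T"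
  shows "S \<subseteq> S + T" "T \<subseteq> S + T"
  using set_plus_intro[OF _ subspace_0[OF assms(2)]] set_plus_intro[OF subspace_0[OF assms(1)]]
  by auto

lemma set_plus_subset_subspace:
  fixes V :: "'a::real_vector set"
  assumes "subspace V" "S \<subseteq> V" "T \<subseteq> V"
  shows "S + T \<subseteq> V"
  using assms by (auto simp: set_plus_def intro: subspace_add)

text \<open>Admissible values are picked on a basis of \<open>V\<close> and extended linearly. The
  vectors for which the extension works form a subspace containing that basis.\<close>

lemma linear_selection:
  fixes L :: "'a::euclidean_space \<Rightarrow> 'b::real_vector" and M :: "'c::real_vector \<Rightarrow> 'b"
  assumes "subspace V" "subspace T" "linear L" "linear M"
    and ex: "\<And>v. v \<in> V \<Longrightarrow> \<exists>u. L v + M u \<in> T"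
  obtains f where "linear f" "\<And>v. v \<in> V \<Longrightarrow> L v + M (f v) \<in> T"
proof -
  obtain b where b: "b \<subseteq> V" "independent b" "V \<subseteq> span b"
    using maximal_independent_subset[of V] by metis
  have "\<forall>v\<in>V. \<exists>u. L v + M u \<in> T"
    using ex by blast
  then obtain g where g: "\<forall>v\<in>V. L v + M (g v) \<in> T"
    by (rule bchoice[THEN exE])
  obtain f where f: "linear f" "\<forall>v\<in>b. f v = g v"
    using linear_independent_extend[OF b(2), of g] by blast
  have "linear (\<lambda>v. L v + M (f v))"
    using linear_compose_add[OF assms(3) linear_compose[OF f(1) assms(4)]] by (simp add: o_def)
  then have "subspace ((\<lambda>v. L v + M (f v)) -` T)"
    by (rule linear_subspace_vimage) fact
  moreover have "b \<subseteq> (\<lambda>v. L v + M (f v)) -` T"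
    using b(1) f(2) g by auto
  ultimately have "V \<subseteq> (\<lambda>v. L v + M (f v)) -` T"
    using b(3) span_minimal by blast
  then show thesis
    using that[OF f(1)] by blast
qed

text \<open>Take \<open>g = - L h\<close> with \<open>h\<close> a right inverse of \<open>M\<close>
  on \<open>V\<close>: the vector \<open>v - h (M v)\<close> lies in \<open>V\<close> and is killed
  by \<open>M\<close>.\<close>

lemma linear_quotient_map:
  fixes L :: "'a::euclidean_space \<Rightarrow> 'b::euclidean_space" and M :: "'a \<Rightarrow> 'c::euclidean_space"
  assumes "subspace V" "linear L" "linear M"
    and ker: "\<And>v. v \<in> V \<Longrightarrow> M v = 0 \<Longrightarrow> L v \<in> T"
  obtains g where "linear g" "\<And>v. v \<in> V \<Longrightarrow> L v + g (M v) \<in> T"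
proof -
  obtain h where h: "range h \<subseteq> V" "linear h" "\<And>v. v \<in> V \<Longrightarrow> M (h (M v)) = M v"
    using linear_exists_right_inverse_on[OF assms(3,1)] by blast
  have "L v + - L (h (M v)) \<in> T" if "v \<in> V" for v
  proof -
    have "v - h (M v) \<in> V"
      using subspace_diff[OF assms(1) that, of "h (M v)"] h(1) by blast
    moreover have "M (v - h (M v)) = 0"
      using h(3)[OF that] by (simp add: linear_diff[OF assms(3)])
    ultimately show ?thesis
      using ker[of "v - h (M v)"] by (simp add: linear_diff[OF assms(2)])
  qed
  moreover have "linear (\<lambda>y. - L (h y))"
    using linear_compose_neg[OF linear_compose[OF h(2) assms(2)]] by (simp add: o_def)
  ultimately show thesis
    using that[of "\<lambda>y. - L (h y)"] by blast
qed

section \<open>Characterisations without friends\<close>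

lemma on_friend_iff:
  "on_friend A B C D V F \<longleftrightarrow>
     (\<forall>v\<in>V. A *v v + B *v (F *v v) \<in> V \<and> C *v v + D *v (F *v v) = 0)"
  by (simp add: on_friend_def image_subset_iff mat_simps)

text \<open>A friend only bundles pointwise inputs into a linear map, which
  \<open>linear_selection\<close> recovers. The pointwise form behaves well under sums.\<close>

lemma output_nulling_iff:
  "output_nulling A B C D V \<longleftrightarrow>
     subspace V \<and> (\<forall>v\<in>V. \<exists>u. A *v v + B *v u \<in> V \<and> C *v v + D *v u = 0)"
  (is "_ \<longleftrightarrow> _ \<and> ?ex")
proof (intro iffI conjI)
  assume "output_nulling A B C D V"
  then show "subspace V" ?ex
    by (auto simp: output_nulling_def on_friend_iff)
next
  assume *: "subspace V \<and> ?ex"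
  \<comment> \<open>Membership in \<open>V \<times> {0}\<close> expresses both conditions at once,
    so one selection meets them with the same input.\<close>
  have "subspace (V \<times> {0::real^'c})"
    using * by (intro subspace_Times subspace_single_0) simp
  moreover have lin: "linear (\<lambda>v. (M *v v, N *v v))"
    for M :: "real^'k^'a" and N :: "real^'k^'c"
    by (rule linearI) (simp_all add: matrix_vector_right_distrib matrix_vector_mult_scaleR)
  moreover have "\<exists>u. (A *v v, C *v v) + (B *v u, D *v u) \<in> V \<times> {0}" if "v \<in> V" for v
    using * that by auto
  ultimately obtain f where f: "linear f" "\<And>v. v \<in> V \<Longrightarrow> (A *v v, C *v v) + (B *v f v, D *v f v) \<in> V \<times> {0}"
    using linear_selection[OF _ _ lin lin] * by blast
  then have "on_friend A B C D V (matrix f)"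
    by (simp add: on_friend_iff matrix_works)
  with * show "output_nulling A B C D V"
    by (auto simp: output_nulling_def)
qed

lemma ic_friend_iff:
  "ic_friend A B C D S G \<longleftrightarrow>
     (\<forall>s\<in>S. \<forall>w. A *v s + B *v w + G *v (C *v s + D *v w) \<in> S)"
proof -
  have "(\<forall>x\<in>dsum S UNIV. P x) \<longleftrightarrow> (\<forall>s\<in>S. \<forall>w. P (vstack s w))"
    for P :: "real^('a + 'b) \<Rightarrow> bool"
    unfolding dsum_def by blast
  then have "ic_friend A B C D S G \<longleftrightarrow>
      (\<forall>s\<in>S. \<forall>w. hstack (A + G ** C) (B + G ** D) *v vstack s w \<in> S)"
    unfolding ic_friend_def image_subset_iff .
  moreover have "hstack (A + G ** C) (B + G ** D) *v vstack s w
      = A *v s + B *v w + G *v (C *v s + D *v w)" for s w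
    by (simp add: mat_simps add_ac)
  ultimately show ?thesis
    by simp
qed

text \<open>An output injection matters only on the range of \<open>[C D]\<close>. If all invisible
  pairs \<open>(s, w)\<close> step into \<open>S\<close>, it is determined there modulo
  \<open>S\<close>, and \<open>linear_quotient_map\<close> constructs it.\<close>

lemma input_containing_iff:
  "input_containing A B C D S \<longleftrightarrow>
     subspace S \<and> (\<forall>s\<in>S. \<forall>w. C *v s + D *v w = 0 \<longrightarrow> A *v s + B *v w \<in> S)"
  (is "_ \<longleftrightarrow> _ \<and> ?ex")
proof (intro iffI conjI)
  assume "input_containing A B C D S"
  then obtain G where "subspace S" and G: "ic_friend A B C D S G"
    by (auto simp: input_containing_def)
  show "subspace S" by fact
  show ?ex
  proof (intro ballI allI impI)
    fix s w
    assume "s \<in> S" "C *v s + D *v w = 0"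
    then show "A *v s + B *v w \<in> S"
      using G[unfolded ic_friend_iff, rule_format, of s w] by simp
  qed
next
  assume *: "subspace S \<and> ?ex"
  have "subspace (S \<times> (UNIV :: (real^'b) set))"
    using * by (intro subspace_Times) simp_all
  moreover have lin: "linear (\<lambda>z. M *v fst z + N *v snd z)"
    for M :: "real^'a^'k" and N :: "real^'b^'k"
    by (rule linearI) (simp_all add: matrix_vector_right_distrib matrix_vector_mult_scaleR scaleR_add_right)
  moreover have "A *v fst z + B *v snd z \<in> S"
    if "z \<in> S \<times> UNIV" "C *v fst z + D *v snd z = 0" for z
    using * that by auto
  ultimately obtain g where g: "linear g"
    "\<And>z. z \<in> S \<times> UNIV \<Longrightarrow> A *v fst z + B *v snd z + g (C *v fst z + D *v snd z) \<in> S"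
    using linear_quotient_map[OF _ lin lin] by blast
  have "ic_friend A B C D S (matrix g)"
    using g(2)[of "(_, _)"] by (simp add: ic_friend_iff matrix_works g(1))
  with * show "input_containing A B C D S"
    by (auto simp: input_containing_def)
qed

section \<open>Extremal subspaces\<close>

text \<open>The vectors having an input that keeps the successor in \<open>W\<close> and the output
  zero form a subspace containing every candidate. So the span \<open>W\<close> of all candidates is
  itself a candidate.\<close>

lemma V_star_greatest:
  shows "output_nulling A B C D (V_star A B C D)"
    and "output_nulling A B C D V \<Longrightarrow> V \<subseteq> V_star A B C D"
proof -
  define W where "W = span (\<Union>(Collect (output_nulling A B C D)))"
  let ?P = "\<lambda>v. \<exists>u. A *v v + B *v u \<in> W \<and> C *v v + D *v u = 0"
  have le: "V \<subseteq> W" if "output_nulling A B C D V" for V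
    using that span_superset unfolding W_def by fastforce
  have W: "subspace W"
    by (simp add: W_def)
  have "subspace (Collect ?P)"
  proof (unfold subspace_def, safe, goal_cases)
    case 1
    show ?case
      by (rule exI[of _ 0]) (simp add: subspace_0[OF W])
  next
    case (2 x y u v)
    have "A *v (x + y) + B *v (u + v) = (A *v x + B *v u) + (A *v y + B *v v)"
      "C *v (x + y) + D *v (u + v) = (C *v x + D *v u) + (C *v y + D *v v)"
      by (simp_all add: matrix_vector_right_distrib algebra_simps)
    with 2 show ?case
      by (intro exI[of _ "u + v"]) (simp add: subspace_add[OF W])
  next
    case (3 c x u)
    have "A *v (c *\<^sub>R x) + B *v (c *\<^sub>R u) = c *\<^sub>R (A *v x + B *v u)"
      "C *v (c *\<^sub>R x) + D *v (c *\<^sub>R u) = c *\<^sub>R (C *v x + D *v u)"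
      by (simp_all add: matrix_vector_mult_scaleR scaleR_add_right)
    with 3 show ?case
      by (intro exI[of _ "c *\<^sub>R u"]) (simp add: subspace_scale[OF W])
  qed
  moreover have "\<Union>(Collect (output_nulling A B C D)) \<subseteq> Collect ?P"
  proof safe
    fix v V
    assume "v \<in> V" "output_nulling A B C D V"
    then show "?P v"
      using le[of V] unfolding output_nulling_iff by blast
  qed
  ultimately have "W \<subseteq> Collect ?P"
    using span_minimal W_def by blast
  then have "output_nulling A B C D W"
    using W by (auto simp: output_nulling_iff)
  with le have "V_star A B C D = W"
    unfolding V_star_def by (intro Greatest_equality)
  then show "output_nulling A B C D (V_star A B C D)"
    and "output_nulling A B C D V \<Longrightarrow> V \<subseteq> V_star A B C D"
    using \<open>output_nulling A B C D W\<close> le by auto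
qed

text \<open>Friends of different candidates need not agree, but the friend-free condition passes to
  arbitrary intersections.\<close>

lemma S_star_least:
  shows "input_containing A B C D (S_star A B C D)"
    and "input_containing A B C D S \<Longrightarrow> S_star A B C D \<subseteq> S"
proof -
  define W where "W = \<Inter>(Collect (input_containing A B C D))"
  have le: "W \<subseteq> S" if "input_containing A B C D S" for S
    using that unfolding W_def by blast
  have "input_containing A B C D W"
    unfolding input_containing_iff W_def by (auto intro: subspace_Inter)
  with le have "S_star A B C D = W"
    unfolding S_star_def by (intro Least_equality)
  then show "input_containing A B C D (S_star A B C D)"
    and "input_containing A B C D S \<Longrightarrow> S_star A B C D \<subseteq> S"
    using \<open>input_containing A B C D W\<close> le by auto
qed

lemma invariant_subspace_iff:
  "invariant_subspace A J \<longleftrightarrow> subspace J \<and> (\<forall>x\<in>J. A *v x \<in> J)"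
  by (auto simp: invariant_subspace_def)

lemma least_invariant_least:
  shows "invariant_subspace A (least_invariant A J)"
    and "J \<subseteq> least_invariant A J"
    and "invariant_subspace A L \<Longrightarrow> J \<subseteq> L \<Longrightarrow> least_invariant A J \<subseteq> L"
proof -
  define W where "W = \<Inter>{L. invariant_subspace A L \<and> J \<subseteq> L}"
  have le: "W \<subseteq> L" if "invariant_subspace A L" "J \<subseteq> L" for L
    using that unfolding W_def by blast
  have W: "invariant_subspace A W" "J \<subseteq> W"
    unfolding invariant_subspace_iff W_def by (auto intro: subspace_Inter)
  with le have "least_invariant A J = W"
    unfolding least_invariant_def by (intro Least_equality) auto
  then show "invariant_subspace A (least_invariant A J)" "J \<subseteq> least_invariant A J"
    and "invariant_subspace A L \<Longrightarrow> J \<subseteq> L \<Longrightarrow> least_invariant A J \<subseteq> L"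
    using W le by auto
qed

lemma greatest_invariant_greatest:
  assumes "subspace J"
  shows "invariant_subspace A (greatest_invariant J A)"
    and "greatest_invariant J A \<subseteq> J"
    and "invariant_subspace A L \<Longrightarrow> L \<subseteq> J \<Longrightarrow> L \<subseteq> greatest_invariant J A"
proof -
  define W where "W = span (\<Union>{L. invariant_subspace A L \<and> L \<subseteq> J})"
  have le: "L \<subseteq> W" if "invariant_subspace A L" "L \<subseteq> J" for L
    using that span_superset unfolding W_def by fastforce
  have WJ: "W \<subseteq> J"
    using assms unfolding W_def by (intro span_minimal) auto
  have W: "subspace W"
    by (simp add: W_def)
  have "subspace ((*v) A -` W)"
    using W by (intro linear_subspace_vimage) simp_all
  moreover have "\<Union>{L. invariant_subspace A L \<and> L \<subseteq> J} \<subseteq> (*v) A -` W"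
    using le by (auto simp: invariant_subspace_iff)
  ultimately have "W \<subseteq> (*v) A -` W"
    using span_minimal W_def by blast
  then have inv: "invariant_subspace A W"
    using W by (auto simp: invariant_subspace_iff)
  with le WJ have "greatest_invariant J A = W"
    unfolding greatest_invariant_def by (intro Greatest_equality) auto
  then show "invariant_subspace A (greatest_invariant J A)" "greatest_invariant J A \<subseteq> J"
    and "invariant_subspace A L \<Longrightarrow> L \<subseteq> J \<Longrightarrow> L \<subseteq> greatest_invariant J A"
    using inv WJ le by auto
qed

section \<open>Spectra of induced maps\<close>

lemma subspace_projection:
  fixes J :: "'a::euclidean_space set"
  assumes "subspace J"
  obtains g where "linear g" "\<And>x. g x \<in> J" "\<And>x. x \<in> J \<Longrightarrow> g x = x"
  using linear_exists_left_inverse_on[OF linear_id assms inj_on_id] that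
  by (metis UNIV_I id_apply image_subset_iff)

text \<open>The residual of a projection onto \<open>J\<close> stands in for the quotient map modulo
  \<open>J\<close>.\<close>

lemma ex_linear_with_kernel:
  fixes J :: "'a::euclidean_space set"
  assumes "subspace J"
  obtains f :: "'a \<Rightarrow> 'a" where "linear f" "\<And>x. f x = 0 \<longleftrightarrow> x \<in> J"
proof -
  obtain g where g: "linear g" "\<And>x. g x \<in> J" "\<And>x. x \<in> J \<Longrightarrow> g x = x"
    using subspace_projection[OF assms] by blast
  have "x - g x = 0 \<longleftrightarrow> x \<in> J" for x
    using g(2)[of x] g(3)[of x] by auto
  moreover have "linear (\<lambda>x. x - g x)"
    using linear_compose_sub[OF linear_ident g(1)] .
  ultimately show thesis
    using that by blast
qed

lemma coeffs_unique:
  fixes b :: "nat \<Rightarrow> 'a::real_vector"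
  assumes indep: "\<forall>c. (\<Sum>i<n. c i *\<^sub>R b i) = 0 \<longrightarrow> (\<forall>i<n. c i = 0)"
    and "(\<Sum>i<n. x i *\<^sub>R b i) = (\<Sum>i<n. y i *\<^sub>R b i)" "i < n"
  shows "x i = y i"
  using indep[THEN spec, of "\<lambda>i. x i - y i"] assms(2,3)
  by (simp add: scaleR_diff_left sum_subtractf)

lemma sum_scaleR_sum:
  fixes b :: "nat \<Rightarrow> 'a::real_vector"
  shows "(\<Sum>k<m. q k *\<^sub>R (\<Sum>i<n. p i k *\<^sub>R b i)) = (\<Sum>i<n. (\<Sum>k<m. p i k * q k) *\<^sub>R b i)"
  unfolding scaleR_sum_right scaleR_sum_left
  by (subst sum.swap) (simp add: mult.commute)

text \<open>Substitute one expansion into the other and compare coefficients. The lengths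
  \<open>m\<close> and \<open>n\<close> are kept apart because equality of two basis lengths is
  derived from this.\<close>

lemma coeffs_inverse:
  fixes b b' :: "nat \<Rightarrow> 'a::real_vector"
  assumes indep: "\<forall>c. (\<Sum>i<n. c i *\<^sub>R b i) = 0 \<longrightarrow> (\<forall>i<n. c i = 0)"
    and P: "\<And>k. k < m \<Longrightarrow> b' k = (\<Sum>i<n. P i k *\<^sub>R b i)"
    and Q: "\<And>j. j < n \<Longrightarrow> b j = (\<Sum>k<m. Q k j *\<^sub>R b' k)"
    and "i < n" "j < n"
  shows "(\<Sum>k<m. P i k * Q k j) = (if i = j then 1 else (0::real))"
proof -
  have "(\<Sum>i<n. (\<Sum>k<m. P i k * Q k j) *\<^sub>R b i) = b j"
    using Q[OF \<open>j < n\<close>] by (simp add: P sum_scaleR_sum)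
  also have "\<dots> = (\<Sum>i<n. (if i = j then 1 else 0) *\<^sub>R b i)"
    using \<open>j < n\<close> by (simp add: if_distrib[of "\<lambda>r. r *\<^sub>R _"] sum.delta cong: if_cong)
  finally have "(\<Sum>i<n. (\<Sum>k<m. P i k * Q k j) *\<^sub>R b i)
    = (\<Sum>i<n. (if i = j then 1 else 0) *\<^sub>R b i)" .
  from coeffs_unique[OF indep this \<open>i < n\<close>] show ?thesis .
qed

text \<open>Two bases of the quotient give similar matrices, so the arbitrary choice in
  \<open>spectrum_on\<close> is harmless. The quotient is read through \<open>f\<close>, whose
  kernel is \<open>J1\<close>.\<close>

lemma induced_matrix_char_poly_unique:
  assumes J: "subspace J1" and inv: "\<And>x. x \<in> J1 \<Longrightarrow> T *v x \<in> J1"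
    and M: "induced_matrix T J2 J1 bs M" and M': "induced_matrix T J2 J1 bs' M'"
  shows "char_poly M = char_poly M'"
proof -
  obtain f :: "real^'a \<Rightarrow> real^'a" where f: "linear f" "\<And>x. f x = 0 \<longleftrightarrow> x \<in> J1"
    using ex_linear_with_kernel[OF J] by blast
  have f_eq: "f x = f y \<longleftrightarrow> x - y \<in> J1" for x y
    using f(2)[of "x - y"] by (simp add: linear_diff[OF f(1)])
  have f_sum: "f (\<Sum>i<n. c i *\<^sub>R v i) = (\<Sum>i<n. c i *\<^sub>R f (v i))" for c v and n :: nat
    by (simp add: linear_sum[OF f(1)] linear_cmul[OF f(1)])
  have f_T: "f (T *v x) = f (T *v y)" if "f x = f y" for x y
    using that inv[of "x - y"] by (simp add: f_eq matrix_vector_mult_diff_distrib)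
  let ?n = "length bs" and ?n' = "length bs'"
  let ?b = "\<lambda>i. f (bs ! i)" and ?b' = "\<lambda>i. f (bs' ! i)"
  have indep: "\<forall>c. (\<Sum>i<length bs. c i *\<^sub>R f (bs ! i)) = 0 \<longrightarrow> (\<forall>i<length bs. c i = 0)"
    if "induced_matrix T J2 J1 bs M" for bs M
    using that unfolding induced_matrix_def by (simp flip: f(2) add: f_sum)
  have ex: "\<exists>c. f x = (\<Sum>i<length bs. c i *\<^sub>R f (bs ! i))"
    if "induced_matrix T J2 J1 bs M" "x \<in> J2" for bs M x
    using that unfolding induced_matrix_def by (simp flip: f_eq add: f_sum)
  have act: "f (T *v (bs ! j)) = (\<Sum>i<length bs. (M $$ (i, j)) *\<^sub>R f (bs ! i))"
    if "induced_matrix T J2 J1 bs M" "j < length bs" for bs M j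
    using that unfolding induced_matrix_def by (simp flip: f_eq add: f_sum)
  have in_J2: "bs ! j \<in> J2" if "induced_matrix T J2 J1 bs M" "j < length bs" for bs M j
    using that unfolding induced_matrix_def by auto
  have "\<forall>k. \<exists>p. k < ?n' \<longrightarrow> ?b' k = (\<Sum>i<?n. p i *\<^sub>R ?b i)"
    using ex[OF M in_J2[OF M']] by blast
  then obtain P where "\<forall>k. k < ?n' \<longrightarrow> ?b' k = (\<Sum>i<?n. P k i *\<^sub>R ?b i)"
    by metis
  then have P: "?b' k = (\<Sum>i<?n. P k i *\<^sub>R ?b i)" if "k < ?n'" for k
    using that by blast
  have "\<forall>k. \<exists>p. k < ?n \<longrightarrow> ?b k = (\<Sum>i<?n'. p i *\<^sub>R ?b' i)"
    using ex[OF M' in_J2[OF M]] by blast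
  then obtain Q where "\<forall>k. k < ?n \<longrightarrow> ?b k = (\<Sum>i<?n'. Q k i *\<^sub>R ?b' i)"
    by metis
  then have Q: "?b k = (\<Sum>i<?n'. Q k i *\<^sub>R ?b' i)" if "k < ?n" for k
    using that by blast
  have PQ: "(\<Sum>k<?n'. P k i * Q j k) = (if i = j then 1 else 0)" if "i < ?n" "j < ?n" for i j
    by (rule coeffs_inverse[where b = ?b and b' = ?b' and P = "\<lambda>i k. P k i" and Q = "\<lambda>k j. Q j k"])
      (use indep[OF M] P Q that in blast)+
  have QP: "(\<Sum>k<?n. Q k i * P j k) = (if i = j then 1 else 0)" if "i < ?n'" "j < ?n'" for i j
    by (rule coeffs_inverse[where b = ?b' and b' = ?b and P = "\<lambda>i k. Q k i" and Q = "\<lambda>k j. P j k"])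
      (use indep[OF M'] P Q that in blast)+
  \<comment> \<open>Both orders are the trace of \<open>PQ\<close>.\<close>
  have "real ?n = (\<Sum>i<?n. \<Sum>k<?n'. P k i * Q i k)"
    by (simp add: PQ)
  also have "\<dots> = (\<Sum>k<?n'. \<Sum>i<?n. Q i k * P k i)"
    by (subst sum.swap) (simp add: mult.commute)
  also have "\<dots> = real ?n'"
    by (simp add: QP)
  finally have n': "?n' = ?n"
    by simp
  \<comment> \<open>This is \<open>M P = P M'\<close> entrywise: both sides are coordinates of the
    class of \<open>T *v (bs' ! j)\<close> in the basis \<open>bs\<close>.\<close>
  have MP: "(\<Sum>i<?n. M $$ (l, i) * P j i) = (\<Sum>k<?n. P k l * M' $$ (k, j))"
    if "j < ?n" "l < ?n" for j l
  proof -
    have "f (T *v (bs' ! j)) = (\<Sum>i<?n. P j i *\<^sub>R f (T *v (bs ! i)))"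
      using f_T[of "bs' ! j" "\<Sum>i<?n. P j i *\<^sub>R bs ! i"] P[of j] \<open>j < ?n\<close>
      by (simp add: f_sum n' linear_sum linear_cmul)
    also have "\<dots> = (\<Sum>l<?n. (\<Sum>i<?n. M $$ (l, i) * P j i) *\<^sub>R ?b l)"
      by (simp add: act[OF M] sum_scaleR_sum)
    finally have "(\<Sum>l<?n. (\<Sum>i<?n. M $$ (l, i) * P j i) *\<^sub>R ?b l)
        = (\<Sum>k<?n. M' $$ (k, j) *\<^sub>R ?b' k)"
      using act[OF M', of j] \<open>j < ?n\<close> by (simp add: n')
    also have "\<dots> = (\<Sum>l<?n. (\<Sum>k<?n. P k l * M' $$ (k, j)) *\<^sub>R ?b l)"
      by (simp add: P n' sum_scaleR_sum)
    finally show ?thesis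
      by (rule coeffs_unique[OF indep[OF M] _ \<open>l < ?n\<close>])
  qed
  let ?P = "Matrix.mat ?n ?n (\<lambda>(i, k). P k i)" and ?Q = "Matrix.mat ?n ?n (\<lambda>(k, i). Q i k)"
  have carr: "M \<in> carrier_mat ?n ?n" "M' \<in> carrier_mat ?n ?n"
    using M M' unfolding induced_matrix_def by (auto simp: n')
  have inv1: "?P * ?Q = 1\<^sub>m ?n"
    by (rule eq_matI) (use PQ in \<open>auto simp: scalar_prod_def atLeast0LessThan n'\<close>)
  moreover have "?Q * ?P = 1\<^sub>m ?n"
    by (rule eq_matI) (use QP in \<open>auto simp: scalar_prod_def atLeast0LessThan n'\<close>)
  moreover have "M = ?P * M' * ?Q"
  proof -
    have "M * ?P = ?P * M'"
      by (rule eq_matI) (use carr MP in \<open>auto simp: scalar_prod_def atLeast0LessThan\<close>)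
    then have "?P * M' * ?Q = M * (?P * ?Q)"
      using carr by (metis assoc_mult_mat mat_carrier)
    then show ?thesis
      using carr by (simp add: inv1)
  qed
  ultimately have "similar_mat M M'"
    using carr by (intro similar_matI[of M M' ?P ?Q ?n]) auto
  then show ?thesis
    by (rule char_poly_similar)
qed

lemma spectrum_on_eqI:
  assumes "subspace J1" "\<And>x. x \<in> J1 \<Longrightarrow> T *v x \<in> J1" "induced_matrix T J2 J1 bs M"
  shows "spectrum_on T J2 J1 = proots (map_poly complex_of_real (char_poly M))"
proof -
  have "\<exists>bs. induced_matrix T J2 J1 bs (SOME M. \<exists>bs. induced_matrix T J2 J1 bs M)"
    using assms(3) by (intro someI_ex[of "\<lambda>M. \<exists>bs. induced_matrix T J2 J1 bs M"]) blast
  then show ?thesis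
    using induced_matrix_char_poly_unique[OF assms(1,2) assms(3)] unfolding spectrum_on_def by metis
qed

lemma ex_induced_matrix:
  assumes J: "subspace J1" "subspace J2" "J1 \<subseteq> J2" and inv: "\<And>x. x \<in> J2 \<Longrightarrow> T *v x \<in> J2"
  obtains bs M where "induced_matrix T J2 J1 bs M"
proof -
  obtain g where g: "linear g" "\<And>x. g x \<in> J1" "\<And>x. x \<in> J1 \<Longrightarrow> g x = x"
    using subspace_projection[OF J(1)] by blast
  \<comment> \<open>\<open>K\<close> is a complement of \<open>J1\<close> in \<open>J2\<close>, so a
    basis of \<open>K\<close> represents a basis of the quotient.\<close>
  define K where "K = {x \<in> J2. g x = 0}"
  have "K = J2 \<inter> g -` {0}"
    by (auto simp: K_def)
  then have K: "subspace K"
    using J(2) g(1) by (simp add: subspace_inter linear_subspace_vimage)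
  have g_g: "g (x - g x) = 0" for x
    by (simp add: linear_diff[OF g(1)] g(2,3))
  obtain b where b: "b \<subseteq> K" "independent b" "K \<subseteq> span b"
    using maximal_independent_subset[of K] by metis
  then have "finite b"
    using independent_imp_finite by blast
  then obtain bs where bs: "set bs = b" "distinct bs"
    using finite_distinct_list by blast
  note bij = bij_betw_nth[OF bs(2) refl refl, unfolded bs(1)]
  have sub: "set bs \<subseteq> J2"
    using b(1) bs(1) by (auto simp: K_def)
  have indep: "\<forall>i<length bs. c i = 0" if "(\<Sum>i<length bs. c i *\<^sub>R bs ! i) \<in> J1" for c
  proof -
    let ?s = "\<Sum>i<length bs. c i *\<^sub>R bs ! i"
    have "?s \<in> K"
      using b(1) bs(1) by (intro subspace_sum[OF K] subspace_scale[OF K]) auto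
    then have "?s = 0"
      using g(3)[OF that] by (simp add: K_def)
    moreover define u where "u v = c (inv_into {..<length bs} ((!) bs) v)" for v
    have u: "u (bs ! i) = c i" if "i < length bs" for i
      using that bij by (simp add: u_def bij_betw_inv_into_left)
    have "(\<Sum>v\<in>b. u v *\<^sub>R v) = ?s"
      by (subst sum.reindex_bij_betw[OF bij, symmetric]) (simp add: u)
    ultimately have "\<forall>v\<in>b. u v = 0"
      using b(2) independent_explicit by metis
    then show ?thesis
      using u bs(1) by (metis nth_mem)
  qed
  have span: "\<exists>c. x - (\<Sum>i<length bs. c i *\<^sub>R bs ! i) \<in> J1" if "x \<in> J2" for x
  proof -
    have "x - g x \<in> K"
      using that J g(2)[of x] by (auto simp: K_def g_g intro: subspace_diff)
    then obtain u where "x - g x = (\<Sum>v\<in>b. u v *\<^sub>R v)"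
      using b(3) span_finite[OF \<open>finite b\<close>] by auto
    then have "x - g x = (\<Sum>i<length bs. u (bs ! i) *\<^sub>R bs ! i)"
      by (subst (asm) sum.reindex_bij_betw[OF bij, symmetric])
    then have "x - (\<Sum>i<length bs. u (bs ! i) *\<^sub>R bs ! i) = g x"
      by (simp add: algebra_simps)
    then show ?thesis
      using g(2) by metis
  qed
  have "\<forall>j. \<exists>c. j < length bs \<longrightarrow> T *v (bs ! j) - (\<Sum>i<length bs. c i *\<^sub>R bs ! i) \<in> J1"
    using span inv sub nth_mem by blast
  then obtain m where "\<forall>j. j < length bs \<longrightarrow> T *v (bs ! j) - (\<Sum>i<length bs. m j i *\<^sub>R bs ! i) \<in> J1"
    by metis
  then have "induced_matrix T J2 J1 bs (Matrix.mat (length bs) (length bs) (\<lambda>(i, j). m j i))"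
    using sub indep span by (simp add: induced_matrix_def)
  then show thesis
    by (rule that)
qed

section \<open>Calculus of spectra on quotients\<close>

text \<open>\<open>induced_matrix\<close> sees \<open>T\<close> only modulo \<open>J1\<close>, so
  both maps have the same induced matrices and even the same chosen one.\<close>

lemma spectrum_on_cong:
  assumes "subspace J1" "\<And>x. x \<in> J2 \<Longrightarrow> T *v x - T' *v x \<in> J1"
  shows "spectrum_on T J2 J1 = spectrum_on T' J2 J1"
proof -
  have *: "T *v x - y \<in> J1 \<longleftrightarrow> T' *v x - y \<in> J1" if "x \<in> J2" for x y
    using subspace_add[OF assms(1), of "T' *v x - y" "T *v x - T' *v x"]
      subspace_diff[OF assms(1), of "T *v x - y" "T *v x - T' *v x"] assms(2)[OF that]
    by auto
  have "induced_matrix T J2 J1 = induced_matrix T' J2 J1"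
    unfolding induced_matrix_def by (intro ext conj_cong refl) (use * nth_mem in blast)
  then show ?thesis
    by (simp add: spectrum_on_def)
qed

text \<open>The second isomorphism theorem, \<open>(S + V) / V\<close> against
  \<open>S / (S \<inter> V)\<close>: representatives and matrix from the right serve unchanged on
  the left, because the maps agree modulo \<open>V\<close>.\<close>

lemma spectrum_on_plus:
  assumes S: "subspace S" "\<And>x. x \<in> S \<Longrightarrow> T' *v x \<in> S" "\<And>x. x \<in> S \<inter> V \<Longrightarrow> T' *v x \<in> V"
    and V: "subspace V" "\<And>x. x \<in> V \<Longrightarrow> T *v x \<in> V"
    and eq: "\<And>x. x \<in> S \<Longrightarrow> T *v x - T' *v x \<in> V"
  shows "spectrum_on T (S + V) V = spectrum_on T' S (S \<inter> V)"
proof -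
  have SV: "subspace (S \<inter> V)"
    using S(1) V(1) by (rule subspace_inter)
  obtain bs M where M: "induced_matrix T' S (S \<inter> V) bs M"
    using ex_induced_matrix[OF SV S(1) _ S(2)] by blast
  then have bs: "bs ! i \<in> S" if "i < length bs" for i
    using that unfolding induced_matrix_def by auto
  have sum: "(\<Sum>i<length bs. c i *\<^sub>R bs ! i) \<in> S" for c
    using bs by (intro subspace_sum[OF S(1)] subspace_scale[OF S(1)]) auto
  have "induced_matrix T (S + V) V bs M"
    unfolding induced_matrix_def
  proof (intro conjI ballI allI impI)
    show "set bs \<subseteq> S + V"
      using M subset_set_plus[OF S(1) V(1)] unfolding induced_matrix_def by blast
    show "M \<in> carrier_mat (length bs) (length bs)"
      using M unfolding induced_matrix_def by blast
    show "c i = 0" if "(\<Sum>i<length bs. c i *\<^sub>R bs ! i) \<in> V" "i < length bs" for c i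
      using M sum that unfolding induced_matrix_def by blast
    show "\<exists>c. x - (\<Sum>i<length bs. c i *\<^sub>R bs ! i) \<in> V" if "x \<in> S + V" for x
    proof -
      from that obtain s v where x: "x = s + v" "s \<in> S" "v \<in> V"
        by (rule set_plus_elim)
      obtain c where "s - (\<Sum>i<length bs. c i *\<^sub>R bs ! i) \<in> V"
        using M x(2) unfolding induced_matrix_def by blast
      from subspace_add[OF V(1) this x(3)] show ?thesis
        by (intro exI[of _ c]) (simp add: x(1) algebra_simps)
    qed
    show "T *v (bs ! j) - (\<Sum>i<length bs. (M $$ (i, j)) *\<^sub>R bs ! i) \<in> V" if "j < length bs" for j
    proof -
      have "T' *v (bs ! j) - (\<Sum>i<length bs. (M $$ (i, j)) *\<^sub>R bs ! i) \<in> V"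
        using M that unfolding induced_matrix_def by blast
      from subspace_add[OF V(1) this eq[OF bs[OF that]]] show ?thesis
        by simp
    qed
  qed
  then show ?thesis
    using spectrum_on_eqI[OF V] spectrum_on_eqI[OF SV _ M] S(2,3) by auto
qed

lemma sum_append_nth:
  fixes xs ys :: "'a::real_vector list"
  shows "(\<Sum>i<length (xs @ ys). c i *\<^sub>R (xs @ ys) ! i)
    = (\<Sum>i<length xs. c i *\<^sub>R xs ! i) + (\<Sum>i<length ys. c (length xs + i) *\<^sub>R ys ! i)"
proof -
  have "(\<Sum>i<m + n. g i) = (\<Sum>i<m. g i) + (\<Sum>i<n. g (m + i))" for g :: "nat \<Rightarrow> 'a" and m n
    by (induction n) (simp_all add: add.assoc)
  then show ?thesis
    by (simp add: nth_append)
qed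

lemma char_poly_four_block_lower_left_zero:
  assumes "M1 \<in> carrier_mat n n" "X \<in> carrier_mat n m" "M2 \<in> carrier_mat m m"
  shows "char_poly (four_block_mat M1 X (0\<^sub>m m n) M2) = char_poly M1 * char_poly (M2 :: 'a::idom mat)"
proof -
  let ?cm = "\<lambda>A. [:0, 1:] \<cdot>\<^sub>m 1\<^sub>m (dim_row A) + map_mat (\<lambda>a. [:- a:]) A"
  have "?cm (four_block_mat M1 X (0\<^sub>m m n) M2)
      = four_block_mat (?cm M1) (map_mat (\<lambda>a. [:- a:]) X) (0\<^sub>m m n) (?cm M2)"
    by (rule eq_matI) (use assms in \<open>auto simp: one_poly_def\<close>)
  then show ?thesis
    unfolding char_poly_defs using assms
    by (simp add: det_four_block_mat_lower_left_zero[of _ n _ m])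
qed

text \<open>Joining a basis of \<open>J2 / J1\<close> with one of \<open>J3 / J2\<close> makes the
  matrix block upper triangular, so characteristic polynomials multiply and their root multisets
  add.\<close>

lemma spectrum_on_add:
  assumes J: "subspace J1" "subspace J2" "subspace J3" "J1 \<subseteq> J2" "J2 \<subseteq> J3"
    and inv: "\<And>x. x \<in> J1 \<Longrightarrow> T *v x \<in> J1" "\<And>x. x \<in> J2 \<Longrightarrow> T *v x \<in> J2" "\<And>x. x \<in> J3 \<Longrightarrow> T *v x \<in> J3"
  shows "spectrum_on T J3 J1 = spectrum_on T J3 J2 + spectrum_on T J2 J1"
proof -
  obtain bs1 M1 where M1: "induced_matrix T J2 J1 bs1 M1"
    using ex_induced_matrix[OF J(1,2,4) inv(2)] by blast
  obtain bs2 M2 where M2: "induced_matrix T J3 J2 bs2 M2"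
    using ex_induced_matrix[OF J(2,3,5) inv(3)] by blast
  let ?n1 = "length bs1" and ?n2 = "length bs2"
  let ?L1 = "\<lambda>c. \<Sum>i<?n1. c i *\<^sub>R bs1 ! i" and ?L2 = "\<lambda>c. \<Sum>i<?n2. c i *\<^sub>R bs2 ! i"
  have set: "set bs1 \<subseteq> J2" "set bs2 \<subseteq> J3"
    and indep1: "\<And>c. ?L1 c \<in> J1 \<Longrightarrow> \<forall>i<?n1. c i = 0"
    and indep2: "\<And>c. ?L2 c \<in> J2 \<Longrightarrow> \<forall>i<?n2. c i = 0"
    and ex1: "\<And>x. x \<in> J2 \<Longrightarrow> \<exists>c. x - ?L1 c \<in> J1"
    and ex2: "\<And>x. x \<in> J3 \<Longrightarrow> \<exists>c. x - ?L2 c \<in> J2"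
    and carr: "M1 \<in> carrier_mat ?n1 ?n1" "M2 \<in> carrier_mat ?n2 ?n2"
    and act1: "\<And>j. j < ?n1 \<Longrightarrow> T *v (bs1 ! j) - ?L1 (\<lambda>i. M1 $$ (i, j)) \<in> J1"
    and act2: "\<And>j. j < ?n2 \<Longrightarrow> T *v (bs2 ! j) - ?L2 (\<lambda>i. M2 $$ (i, j)) \<in> J2"
    using M1 M2 unfolding induced_matrix_def by blast+
  have L1: "?L1 c \<in> J2" for c
    using set(1) by (intro subspace_sum[OF J(2)] subspace_scale[OF J(2)]) auto
  \<comment> \<open>The part of \<open>T *v (bs2 ! j)\<close> left over in \<open>J2\<close> is
    expanded in \<open>bs1\<close> modulo \<open>J1\<close>; the coefficients form column
    \<open>j\<close> of the coupling block \<open>X\<close>.\<close>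
  define \<xi> where
    "\<xi> j = (SOME c. T *v (bs2 ! j) - ?L2 (\<lambda>i. M2 $$ (i, j)) - ?L1 c \<in> J1)" for j
  have \<xi>: "T *v (bs2 ! j) - ?L2 (\<lambda>i. M2 $$ (i, j)) - ?L1 (\<xi> j) \<in> J1" if "j < ?n2" for j
    using someI_ex[OF ex1[OF act2[OF that]]] unfolding \<xi>_def .
  define X where "X = Matrix.mat ?n1 ?n2 (\<lambda>(i, j). \<xi> j i)"
  define M where "M = four_block_mat M1 X (0\<^sub>m ?n2 ?n1) M2"
  have X: "X \<in> carrier_mat ?n1 ?n2"
    by (simp add: X_def)
  have M_index: "M $$ (i, j) = (if i < ?n1 then if j < ?n1 then M1 $$ (i, j) else \<xi> (j - ?n1) i
      else if j < ?n1 then 0 else M2 $$ (i - ?n1, j - ?n1))"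
    if "i < ?n1 + ?n2" "j < ?n1 + ?n2" for i j
    using that carr X by (auto simp: M_def X_def)
  have "induced_matrix T J3 J1 (bs1 @ bs2) M"
    unfolding induced_matrix_def sum_append_nth
  proof (intro conjI ballI allI impI)
    show "set (bs1 @ bs2) \<subseteq> J3"
      using set J by auto
    show "M \<in> carrier_mat (length (bs1 @ bs2)) (length (bs1 @ bs2))"
      using carr by (simp add: M_def)
  next
    fix c :: "nat \<Rightarrow> real" and i
    assume *: "?L1 c + ?L2 (\<lambda>i. c (?n1 + i)) \<in> J1" and i: "i < length (bs1 @ bs2)"
    have "?L2 (\<lambda>i. c (?n1 + i)) \<in> J2"
      using subspace_diff[OF J(2) subsetD[OF J(4) *] L1[of c]] by simp
    from indep2[OF this] have c2: "\<forall>i<?n2. c (?n1 + i) = 0" .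
    with * have "?L1 c \<in> J1"
      by simp
    from indep1[OF this] have c1: "\<forall>i<?n1. c i = 0" .
    show "c i = 0"
      using c1 c2[rule_format, of "i - ?n1"] i by (cases "i < ?n1") simp_all
  next
    fix x
    assume "x \<in> J3"
    from ex2[OF this] obtain c2 where "x - ?L2 c2 \<in> J2" ..
    from ex1[OF this] obtain c1 where "x - ?L2 c2 - ?L1 c1 \<in> J1" ..
    then show "\<exists>c. x - (?L1 c + ?L2 (\<lambda>i. c (?n1 + i))) \<in> J1"
      by (intro exI[of _ "\<lambda>i. if i < ?n1 then c1 i else c2 (i - ?n1)"]) (simp add: algebra_simps)
  next
    fix j
    assume j: "j < length (bs1 @ bs2)"
    show "T *v ((bs1 @ bs2) ! j)
        - (?L1 (\<lambda>i. M $$ (i, j)) + ?L2 (\<lambda>i. M $$ (?n1 + i, j))) \<in> J1"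
    proof (cases "j < ?n1")
      case True
      then show ?thesis
        using act1[of j] by (simp add: M_index nth_append)
    next
      case False
      then show ?thesis
        using \<xi>[of "j - ?n1"] j by (simp add: M_index nth_append algebra_simps)
    qed
  qed
  from spectrum_on_eqI[OF J(1) inv(1) this]
  have "spectrum_on T J3 J1 = proots (map_poly complex_of_real (char_poly M1 * char_poly M2))"
    using carr X by (simp add: M_def char_poly_four_block_lower_left_zero)
  also have "\<dots> = proots (map_poly complex_of_real (char_poly M1))
      + proots (map_poly complex_of_real (char_poly M2))"
  proof -
    have "map_poly complex_of_real (p * q) = map_poly of_real p * map_poly of_real q" for p q
      by (rule poly_eqI) (simp add: coeff_mult coeff_map_poly)
    moreover have "map_poly complex_of_real p \<noteq> 0" if "p \<noteq> 0" for p
      using that by (simp add: poly_eq_iff coeff_map_poly)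
    moreover have "char_poly M1 \<noteq> 0" "char_poly M2 \<noteq> 0"
      using degree_monic_char_poly[OF carr(1)] degree_monic_char_poly[OF carr(2)] by auto
    ultimately show ?thesis
      by (simp add: proots_mult)
  qed
  finally show ?thesis
    using spectrum_on_eqI[OF J(1) inv(1) M1] spectrum_on_eqI[OF J(2) inv(2) M2] by simp
qed

text \<open>Additivity along the constant chain gives a multiset equal to its own double.\<close>

lemma spectrum_on_same:
  assumes "subspace J" "\<And>x. x \<in> J \<Longrightarrow> T *v x \<in> J"
  shows "spectrum_on T J J = {#}"
  using spectrum_on_add[of J J J T] assms by simp

section \<open>Independence of the friend\<close>

text \<open>Changing the friend alters the map only by generators of \<open>R_of\<close>. This makes
  \<open>R_of\<close>, and the spectrum on \<open>V\<close> modulo it, independent of the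
  friend.\<close>

lemma on_friend_diff:
  assumes "subspace V" "on_friend A B C D V F" "on_friend A B C D V F'" "v \<in> V"
  shows "(A + B ** F) *v v - (A + B ** F') *v v \<in> V \<inter> (*v) B ` ker D"
proof -
  let ?u = "F *v v - F' *v v"
  have F: "A *v v + B *v (F *v v) \<in> V" "C *v v + D *v (F *v v) = 0"
    and F': "A *v v + B *v (F' *v v) \<in> V" "C *v v + D *v (F' *v v) = 0"
    using assms(2-4) by (simp_all add: on_friend_iff)
  have "B *v ?u = (A *v v + B *v (F *v v)) - (A *v v + B *v (F' *v v))"
    by (simp add: mat_simps)
  then have "B *v ?u \<in> V"
    using subspace_diff[OF assms(1) F(1) F'(1)] by metis
  moreover have "D *v ?u = (C *v v + D *v (F *v v)) - (C *v v + D *v (F' *v v))"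
    by (simp add: mat_simps)
  then have "?u \<in> ker D"
    using F(2) F'(2) by (simp add: ker_def)
  moreover have "(A + B ** F) *v v - (A + B ** F') *v v = B *v ?u"
    by (simp add: mat_simps)
  ultimately show ?thesis
    by simp
qed

lemma on_friend_invariant:
  assumes "subspace V" "on_friend A B C D V F"
  shows "invariant_subspace (A + B ** F) V"
  using assms by (simp add: invariant_subspace_iff on_friend_iff mat_simps)

text \<open>The subspace built with \<open>F\<close> contains the generators, so passing to
  \<open>F'\<close> perturbs the map only inside it.\<close>

lemma least_invariant_friend_le:
  assumes V: "subspace V" and F: "on_friend A B C D V F" and F': "on_friend A B C D V F'"
  shows "least_invariant (A + B ** F') (V \<inter> (*v) B ` ker D)
    \<subseteq> least_invariant (A + B ** F) (V \<inter> (*v) B ` ker D)" (is "least_invariant _ ?J \<subseteq> ?L")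
proof (rule least_invariant_least(3))
  show "?J \<subseteq> ?L"
    by (rule least_invariant_least(2))
  have L: "subspace ?L" "\<And>x. x \<in> ?L \<Longrightarrow> (A + B ** F) *v x \<in> ?L"
    using least_invariant_least(1) by (auto simp: invariant_subspace_iff)
  have "?L \<subseteq> V"
    by (rule least_invariant_least(3)) (use on_friend_invariant[OF V F] in auto)
  have "(A + B ** F') *v x \<in> ?L" if x: "x \<in> ?L" for x
  proof -
    have "(A + B ** F) *v x - (A + B ** F') *v x \<in> ?J"
      using x \<open>?L \<subseteq> V\<close> by (intro on_friend_diff[OF V F F']) auto
    then have "(A + B ** F) *v x - (A + B ** F') *v x \<in> ?L"
      using \<open>?J \<subseteq> ?L\<close> by blast
    from subspace_diff[OF L(1) L(2)[OF x] this] show ?thesis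
      by simp
  qed
  then show "invariant_subspace (A + B ** F') ?L"
    using L(1) by (simp add: invariant_subspace_iff)
qed

lemma R_of_eq:
  assumes "output_nulling A B C D V" "on_friend A B C D V F"
  shows "R_of A B C D V = least_invariant (A + B ** F) (V \<inter> (*v) B ` ker D)"
  using assms least_invariant_friend_le someI[of "on_friend A B C D V" F]
  unfolding R_of_def Let_def output_nulling_def by (intro equalityI) blast+

lemma R_of_props:
  assumes V: "output_nulling A B C D V" and F: "on_friend A B C D V F"
  shows "invariant_subspace (A + B ** F) (R_of A B C D V)"
    and "R_of A B C D V \<subseteq> V"
    and "V \<inter> (*v) B ` ker D \<subseteq> R_of A B C D V"
    and "output_nulling A B C D (R_of A B C D V)"
proof -
  show *: "invariant_subspace (A + B ** F) (R_of A B C D V)"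
    "V \<inter> (*v) B ` ker D \<subseteq> R_of A B C D V"
    unfolding R_of_eq[OF assms] by (rule least_invariant_least)+
  show le: "R_of A B C D V \<subseteq> V"
    unfolding R_of_eq[OF assms]
    by (rule least_invariant_least(3)) (use V on_friend_invariant[OF _ F] in \<open>auto simp: output_nulling_def\<close>)
  have "A *v x + B *v (F *v x) \<in> R_of A B C D V \<and> C *v x + D *v (F *v x) = 0"
    if "x \<in> R_of A B C D V" for x
    using that * le F by (auto simp: invariant_subspace_iff on_friend_iff mat_simps)
  then show "output_nulling A B C D (R_of A B C D V)"
    using * by (auto simp: output_nulling_iff invariant_subspace_iff)
qed

text \<open>The condition \<open>V \<inter> B ker D \<subseteq> W\<close> says that \<open>W\<close> is self-bounded relative to \<open>V\<close>.\<close>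

lemma self_bounded_friend:
  assumes V: "output_nulling A B C D V" "on_friend A B C D V F"
    and W: "output_nulling A B C D W" "W \<subseteq> V" and "V \<inter> (*v) B ` ker D \<subseteq> W"
  shows "on_friend A B C D W F" "R_of A B C D V = R_of A B C D W"
proof -
  have sub: "subspace V" "subspace W"
    using V W by (auto simp: output_nulling_def)
  have F: "A *v v + B *v (F *v v) \<in> W \<and> C *v v + D *v (F *v v) = 0" if v: "v \<in> W" for v
  proof -
    obtain u where u: "A *v v + B *v u \<in> W" "C *v v + D *v u = 0"
      using W(1) v unfolding output_nulling_iff by blast
    have Fv: "A *v v + B *v (F *v v) \<in> V" "C *v v + D *v (F *v v) = 0"
      using V(2) v W(2) unfolding on_friend_iff by blast+
    \<comment> \<open>The inputs \<open>F *v v\<close> and \<open>u\<close> differ by an element of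
      \<open>ker D\<close> that \<open>B\<close> sends into \<open>V\<close>. Self-boundedness puts
      this effect into \<open>W\<close>.\<close>
    have "B *v (F *v v - u) = (A *v v + B *v (F *v v)) - (A *v v + B *v u)"
      by (simp add: mat_simps)
    then have "B *v (F *v v - u) \<in> V"
      using Fv(1) u(1) W(2) subspace_diff[OF sub(1)] by (metis subsetD)
    moreover have "D *v (F *v v - u) = (C *v v + D *v (F *v v)) - (C *v v + D *v u)"
      by (simp add: mat_simps)
    then have "F *v v - u \<in> ker D"
      using Fv(2) u(2) by (simp add: ker_def)
    ultimately have "B *v (F *v v - u) \<in> W"
      using assms(5) by blast
    from subspace_add[OF sub(2) u(1) this] Fv(2) show ?thesis
      by (simp add: mat_simps)
  qed
  then show "on_friend A B C D W F"
    by (simp add: on_friend_iff)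
  moreover have "V \<inter> (*v) B ` ker D = W \<inter> (*v) B ` ker D"
    using assms(5) W(2) by blast
  ultimately show "R_of A B C D V = R_of A B C D W"
    using R_of_eq V W by metis
qed

lemma R_star_props:
  shows "output_nulling A B C D (R_star A B C D)"
    and "R_star A B C D \<subseteq> V_star A B C D"
    and "V_star A B C D \<inter> (*v) B ` ker D \<subseteq> R_star A B C D"
proof -
  obtain F where "on_friend A B C D (V_star A B C D) F"
    using V_star_greatest(1) unfolding output_nulling_def by blast
  from R_of_props[OF V_star_greatest(1) this] show
    "output_nulling A B C D (R_star A B C D)"
    "R_star A B C D \<subseteq> V_star A B C D"
    "V_star A B C D \<inter> (*v) B ` ker D \<subseteq> R_star A B C D"
    unfolding R_star_def by blast+
qed

section \<open>Input containing subspaces\<close>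

lemma subspace_vimage_im: "subspace ((*v) C -` im D)"
  unfolding im_def by (intro linear_subspace_vimage linear_subspace_image) simp_all

lemma ic_friend_invariant:
  assumes "subspace S" "ic_friend A B C D S G"
  shows "invariant_subspace (A + G ** C) S"
proof -
  have "A *v s + G *v (C *v s) \<in> S" if "s \<in> S" for s
    using assms(2)[unfolded ic_friend_iff, rule_format, OF that, of 0] by simp
  with assms(1) show ?thesis
    by (simp add: invariant_subspace_iff mat_simps)
qed

lemma ic_friend_im:
  assumes "subspace S" "ic_friend A B C D S G"
  shows "B *v w + G *v (D *v w) \<in> S"
  using assms(2)[unfolded ic_friend_iff, rule_format, of 0 w] assms(1) by (simp add: subspace_0)

text \<open>If \<open>C *v y = D *v w\<close>, the injections act on \<open>y\<close> as they would
  on the input \<open>w\<close>. So the difference at \<open>s + y\<close> is a difference of two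
  successors of \<open>(s, w)\<close>, both in \<open>S\<close>.\<close>

lemma ic_friend_diff:
  assumes S: "subspace S" and G: "ic_friend A B C D S G" "ic_friend A B C D S G'"
    and x: "x \<in> S + (*v) C -` im D"
  shows "(A + G ** C) *v x - (A + G' ** C) *v x \<in> S"
proof -
  from x obtain s y where s: "x = s + y" "s \<in> S" "y \<in> (*v) C -` im D"
    by (rule set_plus_elim)
  then obtain w where w: "C *v y = D *v w"
    by (auto simp: im_def)
  have "(A + G ** C) *v x - (A + G' ** C) *v x
      = ((A *v s + B *v w + G *v (C *v s + D *v w)) - (A *v s + B *v w + G' *v (C *v s + D *v w)))"
    by (simp add: s(1) mat_simps w)
  also have "\<dots> \<in> S"
    using G s(2) unfolding ic_friend_iff by (intro subspace_diff[OF S]) blast+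
  finally show ?thesis .
qed

lemma greatest_invariant_friend_le:
  assumes S: "subspace S" and G: "ic_friend A B C D S G" and G': "ic_friend A B C D S G'"
  shows "greatest_invariant (S + (*v) C -` im D) (A + G ** C)
    \<subseteq> greatest_invariant (S + (*v) C -` im D) (A + G' ** C)" (is "?L \<subseteq> greatest_invariant ?J _")
proof -
  have J: "subspace ?J" "S \<subseteq> ?J"
    by (intro subspace_plus[OF S subspace_vimage_im] subset_set_plus(1)[OF S subspace_vimage_im])+
  have L: "subspace ?L" "\<And>x. x \<in> ?L \<Longrightarrow> (A + G ** C) *v x \<in> ?L" "?L \<subseteq> ?J"
    using greatest_invariant_greatest(1,2)[OF J(1)] by (auto simp: invariant_subspace_iff)
  have "S \<subseteq> ?L"
    by (rule greatest_invariant_greatest(3)[OF J(1) ic_friend_invariant[OF S G] J(2)])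
  have "(A + G' ** C) *v x \<in> ?L" if x: "x \<in> ?L" for x
  proof -
    have "(A + G ** C) *v x - (A + G' ** C) *v x \<in> S"
      using x L(3) by (intro ic_friend_diff[OF S G G']) auto
    then have "(A + G ** C) *v x - (A + G' ** C) *v x \<in> ?L"
      using \<open>S \<subseteq> ?L\<close> by blast
    from subspace_diff[OF L(1) L(2)[OF x] this] show ?thesis
      by simp
  qed
  then have "invariant_subspace (A + G' ** C) ?L"
    using L(1) by (simp add: invariant_subspace_iff)
  then show ?thesis
    using L(3) by (intro greatest_invariant_greatest(3)[OF J(1)])
qed

lemma Q_of_eq:
  assumes "input_containing A B C D S" "ic_friend A B C D S G"
  shows "Q_of A B C D S = greatest_invariant (S + (*v) C -` im D) (A + G ** C)"
  using assms greatest_invariant_friend_le someI[of "ic_friend A B C D S" G]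
  unfolding Q_of_def Let_def input_containing_def by (intro equalityI) blast+

lemma Q_of_props:
  assumes S: "input_containing A B C D S" and G: "ic_friend A B C D S G"
  shows "invariant_subspace (A + G ** C) (Q_of A B C D S)"
    and "S \<subseteq> Q_of A B C D S"
    and "Q_of A B C D S \<subseteq> S + (*v) C -` im D"
    and "input_containing A B C D (Q_of A B C D S)"
proof -
  have sub: "subspace S"
    using S by (simp add: input_containing_def)
  have J: "subspace (S + (*v) C -` im D)" "S \<subseteq> S + (*v) C -` im D"
    by (intro subspace_plus[OF sub subspace_vimage_im] subset_set_plus(1)[OF sub subspace_vimage_im])+
  show *: "invariant_subspace (A + G ** C) (Q_of A B C D S)"
    "Q_of A B C D S \<subseteq> S + (*v) C -` im D"
    unfolding Q_of_eq[OF assms] using greatest_invariant_greatest(1,2)[OF J(1)] by auto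
  show le: "S \<subseteq> Q_of A B C D S"
    unfolding Q_of_eq[OF assms]
    by (rule greatest_invariant_greatest(3)[OF J(1) ic_friend_invariant[OF sub G] J(2)])
  have Q: "subspace (Q_of A B C D S)"
    "\<And>s. s \<in> Q_of A B C D S \<Longrightarrow> (A + G ** C) *v s \<in> Q_of A B C D S"
    using * by (auto simp: invariant_subspace_iff)
  have "A *v s + B *v w \<in> Q_of A B C D S"
    if s: "s \<in> Q_of A B C D S" and "C *v s + D *v w = 0" for s w
  proof -
    have "G *v (C *v s) = - (G *v (D *v w))"
      using that(2) by (simp add: add_eq_0_iff2 matrix_vector_mult_uminus_right)
    then have "A *v s + B *v w = (A + G ** C) *v s + (B *v w + G *v (D *v w))"
      by (simp add: mat_simps)
    also have "\<dots> \<in> Q_of A B C D S"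
      by (intro subspace_add[OF Q(1)] Q(2)[OF s] subsetD[OF le] ic_friend_im[OF sub G])
    finally show ?thesis .
  qed
  then show "input_containing A B C D (Q_of A B C D S)"
    using Q(1) by (simp add: input_containing_iff)
qed

text \<open>Dually, \<open>S' \<subseteq> S + C\<^sup>-\<^sup>1 im D\<close> says that \<open>S'\<close> is self-hidden relative to \<open>S\<close>.\<close>

lemma self_hidden_friend:
  assumes S: "input_containing A B C D S" "ic_friend A B C D S G"
    and S': "input_containing A B C D S'" "S \<subseteq> S'" "S' \<subseteq> S + (*v) C -` im D"
  shows "ic_friend A B C D S' G" "Q_of A B C D S = Q_of A B C D S'"
proof -
  have sub: "subspace S" "subspace S'"
    using S S' by (auto simp: input_containing_def)
  have "A *v s + B *v w + G *v (C *v s + D *v w) \<in> S'" if s: "s \<in> S'" for s w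
  proof -
    from s S'(3) have "s \<in> S + (*v) C -` im D" ..
    then obtain t y where t: "s = t + y" "t \<in> S" "y \<in> (*v) C -` im D"
      by (rule set_plus_elim)
    then obtain v where v: "C *v y = D *v v"
      by (auto simp: im_def)
    have "s - t \<in> S'"
      using s t(2) S'(2) by (intro subspace_diff[OF sub(2)]) auto
    then have "y \<in> S'"
      by (simp add: t(1))
    \<comment> \<open>The pair \<open>(y, - v)\<close> is invisible, so its step stays in
      \<open>S'\<close>. The pair \<open>(t, w + v)\<close> has the same measurement as
      \<open>(s, w)\<close>, and on it \<open>G\<close> acts as a friend of
      \<open>S\<close>.\<close>
    moreover have "C *v y + D *v (- v) = 0"
      by (simp add: v matrix_vector_mult_uminus_right)
    ultimately have "A *v y + B *v (- v) \<in> S'"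
      using S'(1) unfolding input_containing_iff by blast
    moreover have "A *v t + B *v (w + v) + G *v (C *v t + D *v (w + v)) \<in> S'"
      using S(2) t(2) S'(2) unfolding ic_friend_iff by blast
    ultimately have "A *v y + B *v (- v) + (A *v t + B *v (w + v) + G *v (C *v t + D *v (w + v))) \<in> S'"
      by (rule subspace_add[OF sub(2)])
    then show ?thesis
      by (simp add: t(1) mat_simps v algebra_simps)
  qed
  then show "ic_friend A B C D S' G"
    by (simp add: ic_friend_iff)
  moreover have "S + (*v) C -` im D = S' + (*v) C -` im D"
  proof
    show "S + (*v) C -` im D \<subseteq> S' + (*v) C -` im D"
      using S'(2) by (rule set_plus_mono2) simp
    show "S' + (*v) C -` im D \<subseteq> S + (*v) C -` im D"
      using S'(3) subset_set_plus(2)[OF sub(1) subspace_vimage_im]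
      by (intro set_plus_subset_subspace subspace_plus[OF sub(1)] subspace_vimage_im)
  qed
  ultimately show "Q_of A B C D S = Q_of A B C D S'"
    using Q_of_eq S S' by metis
qed

lemma Q_star_props:
  shows "input_containing A B C D (Q_star A B C D)"
    and "S_star A B C D \<subseteq> Q_star A B C D"
    and "Q_star A B C D \<subseteq> S_star A B C D + (*v) C -` im D"
proof -
  obtain G where "ic_friend A B C D (S_star A B C D) G"
    using S_star_least(1) unfolding input_containing_def by blast
  from Q_of_props[OF S_star_least(1) this] show
    "input_containing A B C D (Q_star A B C D)"
    "S_star A B C D \<subseteq> Q_star A B C D"
    "Q_star A B C D \<subseteq> S_star A B C D + (*v) C -` im D"
    unfolding Q_star_def by blast+
qed

section \<open>Fixed spectra with an arbitrary friend\<close>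

text \<open>The last hypothesis makes the first quotient zero. In the second spectrum two friends
  agree modulo \<open>R_of\<close>, so \<open>F\<close> may replace the chosen one.\<close>

lemma fixed_on_eq:
  assumes V: "output_nulling A B C D V" and F: "on_friend A B C D V F"
    and UNIV: "V + least_invariant A (im B) = UNIV"
  shows "fixed_on A B C D V = spectrum_on (A + B ** F) V (R_of A B C D V)"
proof -
  define F' where "F' = (SOME F. on_friend A B C D V F)"
  have F': "on_friend A B C D V F'"
    unfolding F'_def using F by (rule someI)
  have sub: "subspace V"
    using V by (simp add: output_nulling_def)
  have "spectrum_on (A + B ** F') V (R_of A B C D V) = spectrum_on (A + B ** F) V (R_of A B C D V)"
    using R_of_props(1,3)[OF V F] on_friend_diff[OF sub F' F]
    by (intro spectrum_on_cong) (auto simp: invariant_subspace_iff)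
  then show ?thesis
    by (simp add: fixed_on_def F'_def[symmetric] Let_def UNIV spectrum_on_same)
qed

lemma fixed_ic_eq:
  assumes S: "input_containing A B C D S" and G: "ic_friend A B C D S G"
    and zero: "S \<inter> greatest_invariant (ker C) A = {0}"
  shows "fixed_ic A B C D S = spectrum_on (A + G ** C) (Q_of A B C D S) S"
proof -
  define G' where "G' = (SOME G. ic_friend A B C D S G)"
  have G': "ic_friend A B C D S G'"
    unfolding G'_def using G by (rule someI)
  have sub: "subspace S"
    using S by (simp add: input_containing_def)
  have "spectrum_on (A + G' ** C) (Q_of A B C D S) S = spectrum_on (A + G ** C) (Q_of A B C D S) S"
    using Q_of_props(3)[OF S G] ic_friend_diff[OF sub G' G]
    by (intro spectrum_on_cong sub) auto
  moreover have "spectrum_on (A + G' ** C) {0} {0} = {#}"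
    by (rule spectrum_on_same) auto
  ultimately show ?thesis
    by (simp add: fixed_ic_def G'_def[symmetric] Let_def zero)
qed

section \<open>Solution triples and their fixed spectra\<close>

text \<open>A pair \<open>S0 \<subseteq> V0\<close> obtained from some controller; its \<open>K\<close> serves the whole family.\<close>

locale decoupling =
  fixes A :: "real^'n^'n" and B :: "real^'m^'n" and H :: "real^'q^'n"
    and C :: "real^'n^'p" and Dy :: "real^'m^'p" and Gy :: "real^'q^'p"
    and E :: "real^'n^'r" and Dz :: "real^'m^'r" and Gz :: "real^'q^'r"
    and K :: "real^'p^'m" and S0 V0 :: "(real^'n) set"
  assumes V0: "output_nulling A B E Dz V0"
    and S0: "input_containing A H C Gy S0"
    and S0_V0: "S0 \<subseteq> V0"
    and loop: "\<And>s w. s \<in> S0 \<Longrightarrow>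
      A *v s + H *v w + B *v (K *v (C *v s + Gy *v w)) \<in> V0 \<and>
      E *v s + Gz *v w + Dz *v (K *v (C *v s + Gy *v w)) = 0"
    and well_posed: "invertible (mat 1 + K ** Dy)"
begin

text \<open>\<open>Vx\<close> treats the disturbance as a further input, \<open>Sx\<close> treats
  \<open>z\<close> as a further measurement; \<open>Ss\<close> belongs to the measurement
  \<open>y\<close> alone.\<close>

abbreviation "Vx \<equiv> V_star A (hstack B H) E (hstack Dz Gz)"
abbreviation "Vm \<equiv> V_m A B H E Dz Gz"
abbreviation "Ss \<equiv> S_star A H C Gy"
abbreviation "Sx \<equiv> S_star A H (vstack C E) (vstack Gy Gz)"
abbreviation "SM \<equiv> S_M A H C Gy E Gz"

section \<open>Self-boundedness of \<open>Vm\<close> and the least subspace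
  \<open>Ss\<close>\<close>

lemma subspaces: "subspace Vx" "subspace Vm" "subspace Ss" "subspace Sx" "subspace SM"
  using V_star_greatest(1) R_star_props(1) S_star_least(1) Q_star_props(1)
  unfolding output_nulling_def input_containing_def V_m_def S_M_def by blast+

lemma output_nulling_le_Vx:
  assumes "output_nulling A B E Dz V"
  shows "V \<subseteq> Vx"
proof (rule V_star_greatest(2))
  have "\<exists>z. A *v v + hstack B H *v z \<in> V \<and> E *v v + hstack Dz Gz *v z = 0" if v: "v \<in> V" for v
  proof -
    obtain u where "A *v v + B *v u \<in> V" "E *v v + Dz *v u = 0"
      using assms v unfolding output_nulling_iff by blast
    then show ?thesis
      by (intro exI[of _ "vstack u 0"]) simp
  qed
  with assms show "output_nulling A (hstack B H) E (hstack Dz Gz) V"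
    unfolding output_nulling_iff by blast
qed

text \<open>These vectors are generators of the reachability subspace \<open>Vm\<close>; this
  self-boundedness is behind most memberships in \<open>Vm\<close> below.\<close>

lemma inputs_in_Vm:
  assumes "B *v u + H *v w \<in> Vx" "Dz *v u + Gz *v w = 0"
  shows "B *v u + H *v w \<in> Vm"
proof -
  have "vstack u w \<in> ker (hstack Dz Gz)" "B *v u + H *v w = hstack B H *v vstack u w"
    using assms(2) by (simp_all add: ker_def)
  then have "B *v u + H *v w \<in> Vx \<inter> (*v) (hstack B H) ` ker (hstack Dz Gz)"
    using assms(1) by blast
  then show ?thesis
    unfolding V_m_def using R_star_props(3) by blast
qed

lemma Vm_step:
  assumes "v \<in> Vm"
  obtains u w where "A *v v + (B *v u + H *v w) \<in> Vm" "E *v v + (Dz *v u + Gz *v w) = 0"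
proof -
  obtain z where z: "A *v v + hstack B H *v z \<in> Vm" "E *v v + hstack Dz Gz *v z = 0"
    using assms R_star_props(1)[of A "hstack B H" E "hstack Dz Gz"]
    unfolding output_nulling_iff V_m_def by blast
  obtain u w where "z = vstack u w"
    using ex_vstack by blast
  with z that show thesis
    by simp
qed

lemma Vm_le_Vx: "Vm \<subseteq> Vx"
  unfolding V_m_def by (rule R_star_props(2))

text \<open>Some inputs keep the successor in \<open>Vm\<close> with zero output. The given ones
  differ from them by inputs without direct output whose effect lies in \<open>Vx\<close>, hence in
  \<open>Vm\<close>.\<close>

lemma Vm_successor:
  assumes v: "v \<in> Vm" and x: "A *v v + (B *v u + H *v w) \<in> Vx" "E *v v + (Dz *v u + Gz *v w) = 0"
  shows "A *v v + (B *v u + H *v w) \<in> Vm"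
proof -
  obtain u' w' where *: "A *v v + (B *v u' + H *v w') \<in> Vm" "E *v v + (Dz *v u' + Gz *v w') = 0"
    using Vm_step[OF v] by blast
  have "B *v (u - u') + H *v (w - w')
      = (A *v v + (B *v u + H *v w)) - (A *v v + (B *v u' + H *v w'))"
    by (simp add: mat_simps)
  moreover have "\<dots> \<in> Vx"
    using x(1) * Vm_le_Vx by (intro subspace_diff[OF subspaces(1)]) blast+
  moreover have "Dz *v (u - u') + Gz *v (w - w')
      = (E *v v + (Dz *v u + Gz *v w)) - (E *v v + (Dz *v u' + Gz *v w'))"
    by (simp add: mat_simps)
  then have "Dz *v (u - u') + Gz *v (w - w') = 0"
    using x(2) *(2) by simp
  ultimately have "B *v (u - u') + H *v (w - w') \<in> Vm"
    by (intro inputs_in_Vm) metis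
  from subspace_add[OF subspaces(2) *(1) this] show ?thesis
    by (simp add: mat_simps algebra_simps)
qed

lemma Ss_le_S0: "Ss \<subseteq> S0"
  using S_star_least(2)[OF S0] .

lemma Ss_successor:
  assumes "s \<in> Ss"
  shows "A *v s + (B *v (K *v (C *v s + Gy *v w)) + H *v w) \<in> Vx"
    and "E *v s + (Dz *v (K *v (C *v s + Gy *v w)) + Gz *v w) = 0"
  using loop[of s w] assms Ss_le_S0 output_nulling_le_Vx[OF V0] by (auto simp: add_ac)

lemma Ss_output_zero:
  assumes "s \<in> Ss" "C *v s + Gy *v w = 0"
  shows "E *v s + Gz *v w = 0"
  using Ss_successor(2)[OF assms(1), of w] assms(2) by simp

text \<open>By minimality it suffices that \<open>Ss \<inter> Vm\<close> is input containing. An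
  invisible step stays in \<open>Ss\<close>, hence in \<open>V0\<close> and \<open>Vx\<close>, with
  zero output, so \<open>Vm_successor\<close> applies with zero control.\<close>

lemma Ss_le_Vm: "Ss \<subseteq> Vm"
proof -
  have "A *v s + H *v w \<in> Ss \<inter> Vm" if s: "s \<in> Ss \<inter> Vm" and y: "C *v s + Gy *v w = 0" for s w
  proof
    show x: "A *v s + H *v w \<in> Ss"
      using S_star_least(1) s y unfolding input_containing_iff by blast
    then have "A *v s + H *v w \<in> Vx"
      using Ss_le_S0 S0_V0 output_nulling_le_Vx[OF V0] by blast
    with Vm_successor[of s 0 w] s Ss_output_zero[OF _ y] show "A *v s + H *v w \<in> Vm"
      by simp
  qed
  then have "input_containing A H C Gy (Ss \<inter> Vm)"
    using subspaces by (auto simp: input_containing_iff intro: subspace_inter)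
  from S_star_least(2)[OF this] show ?thesis
    by blast
qed

text \<open>This frees the loop property from the pair \<open>S0\<close>, \<open>V0\<close>:
  starting in \<open>Ss \<subseteq> Vm\<close>, a successor in \<open>Vx\<close> with zero output
  stays in \<open>Vm\<close>.\<close>

lemma Ss_loop:
  assumes "s \<in> Ss"
  shows "A *v s + H *v w + B *v (K *v (C *v s + Gy *v w)) \<in> Vm"
    and "E *v s + Gz *v w + Dz *v (K *v (C *v s + Gy *v w)) = 0"
  using Vm_successor[OF _ Ss_successor[OF assms]] Ss_successor(2)[OF assms] assms Ss_le_Vm
  by (auto simp: add_ac)

text \<open>The case \<open>s = 0\<close> of \<open>Ss_loop\<close>. Modulo \<open>Vm\<close>, and
  with zero output, it trades disturbances for controls.\<close>

lemma disturbance_loop: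
  "H *v w + B *v (K *v (Gy *v w)) \<in> Vm" "Gz *v w + Dz *v (K *v (Gy *v w)) = 0"
  using Ss_loop[OF subspace_0[OF subspaces(3)], of w] by simp_all

lemma Vm_output_nulling: "output_nulling A B E Dz Vm"
proof -
  have "\<exists>u. A *v v + B *v u \<in> Vm \<and> E *v v + Dz *v u = 0" if v: "v \<in> Vm" for v
  proof -
    obtain u w where *: "A *v v + (B *v u + H *v w) \<in> Vm" "E *v v + (Dz *v u + Gz *v w) = 0"
      using Vm_step[OF v] by blast
    \<comment> \<open>By \<open>disturbance_loop\<close>, the control
      \<open>- K *v (Gy *v w)\<close> does the work of \<open>w\<close> up to a vector of
      \<open>Vm\<close>, with the same output.\<close>
    let ?u = "u - K *v (Gy *v w)"
    have "A *v v + B *v ?u = (A *v v + (B *v u + H *v w)) - (H *v w + B *v (K *v (Gy *v w)))"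
      by (simp add: mat_simps)
    moreover have "\<dots> \<in> Vm"
      by (rule subspace_diff[OF subspaces(2) *(1) disturbance_loop(1)])
    moreover have "E *v v + Dz *v ?u
        = (E *v v + (Dz *v u + Gz *v w)) - (Gz *v w + Dz *v (K *v (Gy *v w)))"
      by (simp add: mat_simps)
    ultimately show ?thesis
      using *(2) disturbance_loop(2)[of w] by (metis diff_zero)
  qed
  then show ?thesis
    using subspaces(2) by (simp add: output_nulling_iff)
qed

text \<open>A pair over \<open>Ss\<close> that is invisible in \<open>y\<close> is invisible in
  \<open>z\<close> too, so the further measurement reveals nothing; minimality gives each
  inclusion.\<close>

lemma Sx_eq: "Sx = Ss"
proof
  have "input_containing A H (vstack C E) (vstack Gy Gz) Ss"
    using S_star_least(1)[of A H C Gy] by (simp add: input_containing_iff vstack_add)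
  then show le: "Sx \<subseteq> Ss"
    by (rule S_star_least(2))
  have "A *v s + H *v w \<in> Sx" if s: "s \<in> Sx" and y: "C *v s + Gy *v w = 0" for s w
  proof -
    have "E *v s + Gz *v w = 0"
      using s le y by (intro Ss_output_zero) auto
    with s y show ?thesis
      using S_star_least(1)[of A H "vstack C E" "vstack Gy Gz"]
      by (simp add: input_containing_iff vstack_add)
  qed
  then have "input_containing A H C Gy Sx"
    using subspaces(4) by (simp add: input_containing_iff)
  then show "Ss \<subseteq> Sx"
    by (rule S_star_least(2))
qed

lemma Ss_le_SM: "Ss \<subseteq> SM"
  using Q_star_props(2)[of A H "vstack C E" "vstack Gy Gz"] by (simp add: S_M_def Sx_eq)

text \<open>Self-hiddenness for the extended measurement: up to a disturbance, \<open>s\<close>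
  looks in both \<open>y\<close> and \<open>z\<close> like a state of \<open>Ss\<close>.\<close>

lemma SM_decompose:
  assumes "s \<in> SM"
  obtains t w where "t \<in> Ss" "C *v (s - t) = Gy *v w" "E *v (s - t) = Gz *v w"
proof -
  have "s \<in> Ss + (*v) (vstack C E) -` im (vstack Gy Gz)"
    using assms Q_star_props(3)[of A H "vstack C E" "vstack Gy Gz"]
    unfolding S_M_def Sx_eq by blast
  then obtain t y where "s = t + y" "t \<in> Ss" "y \<in> (*v) (vstack C E) -` im (vstack Gy Gz)"
    by (rule set_plus_elim)
  then show thesis
    using that by (auto simp: im_def)
qed

text \<open>The pair \<open>(t, w + v)\<close> over \<open>Ss\<close> has the same \<open>y\<close>
  and \<open>z\<close> as \<open>(s, w)\<close>, which reduces the claim to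
  \<open>Ss_output_zero\<close>.\<close>

lemma SM_output_zero:
  assumes s: "s \<in> SM" and y: "C *v s + Gy *v w = 0"
  shows "E *v s + Gz *v w = 0"
proof -
  obtain t v where t: "t \<in> Ss" "C *v (s - t) = Gy *v v" "E *v (s - t) = Gz *v v"
    using SM_decompose[OF s] by blast
  have "C *v t + Gy *v (w + v) = C *v s + Gy *v w"
    using t(2) by (simp add: mat_simps algebra_simps)
  then have "E *v t + Gz *v (w + v) = 0"
    using y by (intro Ss_output_zero t(1)) simp
  then show ?thesis
    using t(3) by (simp add: mat_simps algebra_simps)
qed

section \<open>The family of input containing subspaces\<close>

lemma SM_input_containing: "input_containing A H C Gy SM"
  using Q_star_props(1)[of A H "vstack C E" "vstack Gy Gz"] SM_output_zero
  by (auto simp: input_containing_iff S_M_def vstack_add)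

text \<open>The difference \<open>s - t\<close> stays in \<open>S\<close> because
  \<open>Ss \<subseteq> S\<close>. With the disturbance \<open>- w\<close> it is invisible in
  \<open>y\<close>, so its step remains in \<open>S\<close>.\<close>

lemma family_decompose:
  assumes S: "input_containing A H C Gy S" "S \<subseteq> SM" and s: "s \<in> S"
  obtains t w where "t \<in> Ss" "C *v (s - t) = Gy *v w" "E *v (s - t) = Gz *v w"
    "s - t \<in> S" "A *v (s - t) - H *v w \<in> S"
proof -
  obtain t w where t: "t \<in> Ss" "C *v (s - t) = Gy *v w" "E *v (s - t) = Gz *v w"
    using SM_decompose[of s] S(2) s by blast
  have "subspace S"
    using S(1) by (simp add: input_containing_def)
  then have st: "s - t \<in> S"
    using s t(1) S_star_least(2)[OF S(1)] by (intro subspace_diff) auto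
  moreover have "C *v (s - t) + Gy *v (- w) = 0"
    using t(2) by (simp add: matrix_vector_mult_uminus_right)
  ultimately have "A *v (s - t) + H *v (- w) \<in> S"
    using S(1) unfolding input_containing_iff by blast
  then show thesis
    using that[OF t st] by (simp add: matrix_vector_mult_uminus_right)
qed

text \<open>The pairs \<open>(s, w)\<close> and \<open>(t, w + v)\<close> give the same measurement,
  hence the same control through \<open>K\<close>. Their steps differ by
  \<open>A *v (s - t) - H *v v\<close>, which lies in \<open>S\<close>, and their outputs
  agree.\<close>

lemma family_loop:
  assumes S: "input_containing A H C Gy S" "S \<subseteq> SM" and s: "s \<in> S"
  shows "A *v s + H *v w + B *v (K *v (C *v s + Gy *v w)) \<in> S + Vm"
    and "E *v s + Gz *v w + Dz *v (K *v (C *v s + Gy *v w)) = 0"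
proof -
  obtain t v where t: "t \<in> Ss" "C *v (s - t) = Gy *v v" "E *v (s - t) = Gz *v v"
    "A *v (s - t) - H *v v \<in> S"
    using family_decompose[OF assms] by blast
  have y: "C *v t + Gy *v (w + v) = C *v s + Gy *v w"
    using t(2) by (simp add: mat_simps algebra_simps)
  have "A *v s + H *v w + B *v (K *v (C *v s + Gy *v w))
      = (A *v (s - t) - H *v v)
        + (A *v t + H *v (w + v) + B *v (K *v (C *v t + Gy *v (w + v))))"
    unfolding y by (simp add: mat_simps)
  also have "\<dots> \<in> S + Vm"
    by (rule set_plus_intro[OF t(4) Ss_loop(1)[OF t(1)]])
  finally show "A *v s + H *v w + B *v (K *v (C *v s + Gy *v w)) \<in> S + Vm" .
  have "E *v s + Gz *v w + Dz *v (K *v (C *v s + Gy *v w))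
      = (E *v (s - t) - Gz *v v)
        + (E *v t + Gz *v (w + v) + Dz *v (K *v (C *v t + Gy *v (w + v))))"
    unfolding y by (simp add: mat_simps)
  also have "\<dots> = 0"
    using t(3) Ss_loop(2)[OF t(1)] by simp
  finally show "E *v s + Gz *v w + Dz *v (K *v (C *v s + Gy *v w)) = 0" .
qed

lemma family_output_nulling:
  assumes S: "input_containing A H C Gy S" "S \<subseteq> SM"
  shows "output_nulling A B E Dz (S + Vm)"
proof -
  have sub: "subspace S"
    using S(1) by (simp add: input_containing_def)
  have SV: "subspace (S + Vm)" "Vm \<subseteq> S + Vm"
    using subspace_plus[OF sub subspaces(2)] subset_set_plus(2)[OF sub subspaces(2)] by blast+
  have "\<exists>u. A *v x + B *v u \<in> S + Vm \<and> E *v x + Dz *v u = 0" if "x \<in> S + Vm" for x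
  proof -
    from that obtain s v where x: "x = s + v" "s \<in> S" "v \<in> Vm"
      by (rule set_plus_elim)
    \<comment> \<open>The \<open>S\<close> part is controlled by \<open>K\<close> at zero
      disturbance, the \<open>Vm\<close> part by an input of its own.\<close>
    let ?u = "K *v (C *v s)"
    have s: "A *v s + B *v ?u \<in> S + Vm" "E *v s + Dz *v ?u = 0"
      using family_loop[OF S x(2), of 0] by simp_all
    obtain u where v: "A *v v + B *v u \<in> Vm" "E *v v + Dz *v u = 0"
      using Vm_output_nulling x(3) unfolding output_nulling_iff by blast
    have "A *v x + B *v (?u + u) = (A *v s + B *v ?u) + (A *v v + B *v u)"
      by (simp add: x(1) matrix_vector_right_distrib)
    also have "\<dots> \<in> S + Vm"
      by (rule subspace_add[OF SV(1) s(1) subsetD[OF SV(2) v(1)]])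
    finally have "A *v x + B *v (?u + u) \<in> S + Vm" .
    moreover have "E *v x + Dz *v (?u + u) = (E *v s + Dz *v ?u) + (E *v v + Dz *v u)"
      by (simp add: x(1) matrix_vector_right_distrib)
    then have "E *v x + Dz *v (?u + u) = 0"
      by (simp only: s(2) v(2) add_0)
    ultimately show ?thesis
      by (intro exI conjI)
  qed
  then show ?thesis
    using SV(1) by (simp add: output_nulling_iff)
qed

lemma family_solution_triple:
  assumes S: "input_containing A H C Gy S" "S \<subseteq> SM"
  shows "solution_triple A B H C Dy Gy E Dz Gz S (S + Vm) K"
  unfolding solution_triple_def
proof (intro conjI)
  have sub: "subspace S"
    using S(1) by (simp add: input_containing_def)
  have SV: "Vm \<subseteq> S + Vm" "S \<subseteq> S + Vm"
    using subset_set_plus[OF sub subspaces(2)] by blast+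
  show "output_nulling A B E Dz (S + Vm)"
    by (rule family_output_nulling[OF S])
  show "S \<subseteq> S + Vm"
    by fact
  show "im (vstack H Gz) \<subseteq> dsum (S + Vm) {0} + im (vstack B Dz)"
  proof
    fix x assume "x \<in> im (vstack H Gz)"
    then obtain w where x: "x = vstack (H *v w) (Gz *v w)"
      by (auto simp: im_def)
    let ?u = "K *v (Gy *v w)"
    have "vstack (H *v w + B *v ?u) (Gz *v w + Dz *v ?u) \<in> dsum (S + Vm) {0}"
      using disturbance_loop[of w] SV(1) by auto
    moreover have "vstack B Dz *v (- ?u) \<in> im (vstack B Dz)"
      by (auto simp: im_def)
    moreover have "x = vstack (H *v w + B *v ?u) (Gz *v w + Dz *v ?u) + vstack B Dz *v (- ?u)"
      unfolding x vstack_mult_vec vstack_add by (simp add: matrix_vector_mult_uminus_right)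
    ultimately show "x \<in> dsum (S + Vm) {0} + im (vstack B Dz)"
      by (metis set_plus_intro)
  qed
  show "dsum S UNIV \<inter> ker (hstack C Gy) \<subseteq> ker (hstack E Gz)"
    using SM_output_zero S(2) by (auto simp: dsum_def ker_def)
  show "(*v) (vstack (hstack (A + B ** K ** C) (H + B ** K ** Gy))
      (hstack (E + Dz ** K ** C) (Gz + Dz ** K ** Gy))) ` dsum S UNIV \<subseteq> dsum (S + Vm) {0}"
  proof (rule image_subsetI)
    fix x :: "real^('n + 'q)" assume "x \<in> dsum S UNIV"
    then obtain s w where x: "x = vstack s w" "s \<in> S"
      by (auto simp: dsum_def)
    have "(A + B ** K ** C) *v s + (H + B ** K ** Gy) *v w
        = A *v s + H *v w + B *v (K *v (C *v s + Gy *v w))"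
      "(E + Dz ** K ** C) *v s + (Gz + Dz ** K ** Gy) *v w
        = E *v s + Gz *v w + Dz *v (K *v (C *v s + Gy *v w))"
      by (simp_all add: mat_simps)
    then show "vstack (hstack (A + B ** K ** C) (H + B ** K ** Gy))
      (hstack (E + Dz ** K ** C) (Gz + Dz ** K ** Gy)) *v x \<in> dsum (S + Vm) {0}"
      using family_loop[OF S x(2), of w] by (simp add: x(1))
  qed
qed (rule S well_posed)+

text \<open>As \<open>SM + Vm\<close> is output nulling, an invisible step from the intersection
  lands in \<open>Vx\<close> with zero output, and \<open>Vm_successor\<close> with zero control
  returns it to \<open>Vm\<close>.\<close>

lemma Vm_Int_SM_input_containing: "input_containing A H C Gy (Vm \<inter> SM)"
proof -
  have "A *v s + H *v w \<in> Vm \<inter> SM" if s: "s \<in> Vm \<inter> SM" and y: "C *v s + Gy *v w = 0" for s w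
  proof
    show "A *v s + H *v w \<in> SM"
      using SM_input_containing s y unfolding input_containing_iff by blast
    have "A *v s + H *v w \<in> SM + Vm"
      using family_loop(1)[OF SM_input_containing order_refl, of s w] s y by simp
    then have "A *v s + H *v w \<in> Vx"
      using output_nulling_le_Vx[OF family_output_nulling[OF SM_input_containing order_refl]] by blast
    then show "A *v s + H *v w \<in> Vm"
      using Vm_successor[of s 0 w] s SM_output_zero[OF _ y] by simp
  qed
  then show ?thesis
    using subspaces by (auto simp: input_containing_iff intro: subspace_inter)
qed

section \<open>Fixed spectra of the family\<close>

lemma self_bounded:
  assumes "output_nulling A B E Dz V"
  shows "V \<inter> (*v) B ` ker Dz \<subseteq> Vm"
proof
  fix x assume "x \<in> V \<inter> (*v) B ` ker Dz"
  then obtain u where u: "x = B *v u" "Dz *v u = 0" "x \<in> V"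
    by (auto simp: ker_def)
  then show "x \<in> Vm"
    using inputs_in_Vm[of u 0] output_nulling_le_Vx[OF assms] by auto
qed

text \<open>The sum is \<open>A\<close>-invariant: the control that keeps \<open>v\<close> in
  \<open>V\<close> is compensated inside the reachable part. It contains \<open>im H\<close> because
  modulo \<open>V\<close> a disturbance acts like a control.\<close>

lemma reachable_UNIV:
  assumes "reachable A (hstack B H)" and V: "output_nulling A B E Dz V" "Vm \<subseteq> V"
  shows "V + least_invariant A (im B) = UNIV"
proof -
  let ?R = "least_invariant A (im B)"
  have R: "subspace ?R" "\<And>x. x \<in> ?R \<Longrightarrow> A *v x \<in> ?R" "im B \<subseteq> ?R"
    using least_invariant_least(1)[of A "im B"] least_invariant_least(2)[of "im B" A]
    by (auto simp: invariant_subspace_iff)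
  then have BR: "B *v u \<in> ?R" for u
    by (auto simp: im_def)
  have sub: "subspace V"
    using V(1) by (simp add: output_nulling_def)
  have VR: "subspace (V + ?R)"
    by (rule subspace_plus[OF sub R(1)])
  have "A *v x \<in> V + ?R" if "x \<in> V + ?R" for x
  proof -
    from that obtain v r where x: "x = v + r" "v \<in> V" "r \<in> ?R"
      by (rule set_plus_elim)
    obtain u where "A *v v + B *v u \<in> V"
      using V(1) x(2) unfolding output_nulling_iff by blast
    moreover have "A *v r - B *v u \<in> ?R"
      by (intro subspace_diff[OF R(1)] R(2) x BR)
    ultimately have "(A *v v + B *v u) + (A *v r - B *v u) \<in> V + ?R"
      by (rule set_plus_intro)
    then show ?thesis
      by (simp add: x(1) matrix_vector_right_distrib)
  qed
  then have "invariant_subspace A (V + ?R)"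
    using VR by (simp add: invariant_subspace_iff)
  moreover have "im (hstack B H) \<subseteq> V + ?R"
  proof
    fix x assume "x \<in> im (hstack B H)"
    then obtain z where "x = hstack B H *v z"
      by (auto simp: im_def)
    moreover obtain u w where "z = vstack u w"
      using ex_vstack by blast
    ultimately have "x = (H *v w + B *v (K *v (Gy *v w))) + B *v (u - K *v (Gy *v w))"
      by (simp add: mat_simps)
    also have "\<dots> \<in> V + ?R"
      using disturbance_loop(1) V(2) BR by (intro set_plus_intro) blast+
    finally show "x \<in> V + ?R" .
  qed
  ultimately have "least_invariant A (im (hstack B H)) \<subseteq> V + ?R"
    by (rule least_invariant_least(3))
  then show ?thesis
    using assms(1) by (simp add: reachable_def top.extremum_unique)
qed

lemma subspace_ker: "subspace (ker M)"
  by (simp add: subspace_def ker_def matrix_vector_right_distrib matrix_vector_mult_scaleR)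

text \<open>By \<open>SM_output_zero\<close> with \<open>w = 0\<close>, states of \<open>S\<close>
  unseen by \<open>C\<close> are unseen by \<open>E\<close>. So the intersection is
  \<open>A\<close>-invariant and unobservable from both outputs together.\<close>

lemma observable_zero:
  assumes "observable (vstack C E) A" and S: "input_containing A H C Gy S" "S \<subseteq> SM"
  shows "S \<inter> greatest_invariant (ker C) A = {0}"
proof -
  let ?N = "greatest_invariant (ker C) A"
  have N: "subspace ?N" "\<And>x. x \<in> ?N \<Longrightarrow> A *v x \<in> ?N" "\<And>x. x \<in> ?N \<Longrightarrow> C *v x = 0"
    using greatest_invariant_greatest(1,2)[OF subspace_ker[of C]]
    by (auto simp: invariant_subspace_iff ker_def)
  have sub: "subspace S"
    using S(1) by (simp add: input_containing_def)
  have "A *v x \<in> S" if "x \<in> S" "x \<in> ?N" for x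
    using S(1)[unfolded input_containing_iff] that N(3)[OF that(2)]
    by (metis add.right_neutral matrix_vector_mult_0_right)
  then have "invariant_subspace A (S \<inter> ?N)"
    using N(2) by (auto simp: invariant_subspace_iff intro: subspace_inter[OF sub N(1)])
  moreover have "S \<inter> ?N \<subseteq> ker (vstack C E)"
    using N(3) SM_output_zero[of _ 0] S(2) by (auto simp: ker_def)
  ultimately have "S \<inter> ?N \<subseteq> greatest_invariant (ker (vstack C E)) A"
    by (rule greatest_invariant_greatest(3)[OF subspace_ker])
  then show ?thesis
    using assms(1) subspace_0[OF sub] subspace_0[OF N(1)] by (auto simp: observable_def)
qed

text \<open>By \<open>spectrum_on_plus\<close> the maps need only be compared on \<open>S\<close>
  modulo \<open>Vm\<close>. On the part \<open>t\<close> of \<open>s\<close> in \<open>Ss\<close>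
  both stay in \<open>Vm\<close>; on \<open>s - t\<close> the hidden disturbance \<open>w\<close>
  links \<open>F\<close> and \<open>G\<close>.\<close>

lemma family_spectrum:
  assumes S: "input_containing A H C Gy S" "Vm \<inter> SM \<subseteq> S" "S \<subseteq> SM"
    and F: "on_friend A B E Dz (S + Vm) F" and G: "ic_friend A H C Gy (Vm \<inter> SM) G"
    and F_Vm: "on_friend A B E Dz Vm F" and G_S: "ic_friend A H C Gy S G"
  shows "spectrum_on (A + B ** F) (S + Vm) Vm = spectrum_on (A + G ** C) S (Vm \<inter> SM)"
proof -
  have sub: "subspace S" "subspace (Vm \<inter> SM)"
    using S(1) subspaces by (simp_all add: input_containing_def subspace_inter)
  have SV: "subspace (S + Vm)" "S \<subseteq> S + Vm" "Vm \<subseteq> S + Vm"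
    using subspace_plus[OF sub(1) subspaces(2)] subset_set_plus[OF sub(1) subspaces(2)] by blast+
  have Int: "S \<inter> Vm = Vm \<inter> SM"
    using S by blast
  have inv: "\<And>x. x \<in> S \<Longrightarrow> (A + G ** C) *v x \<in> S"
    "\<And>x. x \<in> Vm \<inter> SM \<Longrightarrow> (A + G ** C) *v x \<in> Vm \<inter> SM"
    "\<And>x. x \<in> Vm \<Longrightarrow> (A + B ** F) *v x \<in> Vm"
    using ic_friend_invariant[OF sub(1) G_S] ic_friend_invariant[OF sub(2) G]
      on_friend_invariant[OF subspaces(2) F_Vm]
    by (simp_all only: invariant_subspace_iff)
  have diff: "(A + B ** F) *v s - (A + G ** C) *v s \<in> Vm" if s: "s \<in> S" for s
  proof -
    obtain t w where t: "t \<in> Ss" "C *v (s - t) = Gy *v w" "E *v (s - t) = Gz *v w"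
      "s - t \<in> S" "A *v (s - t) - H *v w \<in> S"
      using family_decompose[OF S(1,3) s] by blast
    let ?x = "s - t"
    have tm: "t \<in> Vm" "t \<in> Vm \<inter> SM"
      using t(1) Ss_le_Vm Ss_le_SM by blast+
    have Fx: "A *v ?x + B *v (F *v ?x) \<in> S + Vm" "E *v ?x + Dz *v (F *v ?x) = 0"
      using F[unfolded on_friend_iff, rule_format, OF subsetD[OF SV(2) t(4)]] by simp_all
    have "B *v (F *v ?x) + H *v w = (A *v ?x + B *v (F *v ?x)) - (A *v ?x - H *v w)"
      by simp
    also have "\<dots> \<in> S + Vm"
      by (rule subspace_diff[OF SV(1) Fx(1) subsetD[OF SV(2) t(5)]])
    finally have "B *v (F *v ?x) + H *v w \<in> Vx"
      using output_nulling_le_Vx[OF family_output_nulling[OF S(1,3)]] by blast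
    then have 1: "B *v (F *v ?x) + H *v w \<in> Vm"
      using Fx(2) by (intro inputs_in_Vm) (simp_all add: t(3) add.commute)
    have 2: "H *v w + G *v (Gy *v w) \<in> Vm"
      using ic_friend_im[OF sub(2) G] by blast
    have 3: "(A + B ** F) *v t - (A + G ** C) *v t \<in> Vm"
      by (rule subspace_diff[OF subspaces(2) inv(3)[OF tm(1)] IntD1[OF inv(2)[OF tm(2)]]])
    have "(A + B ** F) *v s - (A + G ** C) *v s
      = (B *v (F *v ?x) - G *v (C *v ?x)) + ((A + B ** F) *v t - (A + G ** C) *v t)"
      by (simp add: mat_simps)
    \<comment> \<open>Inserting \<open>H *v w\<close> leaves one term in \<open>Vm\<close> by
      self-boundedness and one by input containment of \<open>Vm \<inter> SM\<close>.\<close>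
    also have "\<dots> = (B *v (F *v ?x) + H *v w) - (H *v w + G *v (Gy *v w))
        + ((A + B ** F) *v t - (A + G ** C) *v t)"
      unfolding t(2) by simp
    also have "\<dots> \<in> Vm"
      by (intro subspace_add[OF subspaces(2)] subspace_diff[OF subspaces(2)] 1 2 3)
    finally show ?thesis .
  qed
  have "(A + G ** C) *v x \<in> Vm" if "x \<in> S \<inter> Vm" for x
    using inv(2)[of x] that unfolding Int by blast
  from spectrum_on_plus[OF sub(1) inv(1) this subspaces(2) inv(3) diff] show ?thesis
    unfolding Int .
qed

text \<open>Additivity is applied to \<open>R \<subseteq> Vm \<subseteq> S + Vm\<close> and
  \<open>Vm \<inter> SM \<subseteq> S \<subseteq> Q\<close>, where \<open>R\<close> and
  \<open>Q\<close> are common to the family. Then \<open>family_spectrum\<close> matches the two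
  quotients that vary with \<open>S\<close>.\<close>

lemma family_sigma_fixed:
  assumes reach: "reachable A (hstack B H)" and obs: "observable (vstack C E) A"
    and S: "input_containing A H C Gy S" "Vm \<inter> SM \<subseteq> S" "S \<subseteq> SM"
  shows "sigma_fixed A B H C Gy E Dz S (S + Vm) = sigma_fixed A B H C Gy E Dz (Vm \<inter> SM) Vm"
proof -
  let ?V = "S + Vm" and ?S1 = "Vm \<inter> SM"
  have sub: "subspace S" "subspace ?S1"
    using S(1) subspaces by (simp_all add: input_containing_def subspace_inter)
  have le: "Vm \<subseteq> ?V"
    using subset_set_plus(2)[OF sub(1) subspaces(2)] .
  note V = family_output_nulling[OF S(1,3)]
  note S1 = Vm_Int_SM_input_containing
  obtain F where F: "on_friend A B E Dz ?V F"
    using V by (auto simp: output_nulling_def)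
  \<comment> \<open>Output nulling friends pass down: the friend chosen for the larger
    \<open>S + Vm\<close> also serves \<open>Vm\<close>.\<close>
  note Fm = self_bounded_friend[OF V F Vm_output_nulling le self_bounded[OF V]]
  obtain G where G: "ic_friend A H C Gy ?S1 G"
    using S1 by (auto simp: input_containing_def)
  have "S \<subseteq> ?S1 + (*v) C -` im Gy"
  proof
    fix s assume "s \<in> S"
    then obtain t w where t: "t \<in> Ss" "C *v (s - t) = Gy *v w"
      using SM_decompose S(3) by blast
    then have "t + (s - t) \<in> ?S1 + (*v) C -` im Gy"
      using Ss_le_Vm Ss_le_SM by (intro set_plus_intro) (auto simp: im_def)
    then show "s \<in> ?S1 + (*v) C -` im Gy"
      by simp
  qed
  \<comment> \<open>Input containing friends pass up: the friend chosen for the smaller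
    \<open>Vm \<inter> SM\<close> also serves \<open>S\<close>.\<close>
  note GS = self_hidden_friend[OF S1 G S(1,2) this]
  note R = R_of_props[OF Vm_output_nulling Fm(1)]
  have "fixed_on A B E Dz ?V = spectrum_on (A + B ** F) ?V (R_of A B E Dz Vm)"
    using fixed_on_eq[OF V F reachable_UNIV[OF reach V le]] Fm(2) by simp
  also have "\<dots> = spectrum_on (A + B ** F) ?V Vm + spectrum_on (A + B ** F) Vm (R_of A B E Dz Vm)"
    using R(1,2) on_friend_invariant[OF _ F] on_friend_invariant[OF subspaces(2) Fm(1)] V le
    by (intro spectrum_on_add) (auto simp: invariant_subspace_iff output_nulling_def)
  also have "spectrum_on (A + B ** F) Vm (R_of A B E Dz Vm) = fixed_on A B E Dz Vm"
    using fixed_on_eq[OF Vm_output_nulling Fm(1) reachable_UNIV[OF reach Vm_output_nulling order_refl]]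
    by simp
  finally have on: "fixed_on A B E Dz ?V = spectrum_on (A + B ** F) ?V Vm + fixed_on A B E Dz Vm" .
  note Q = Q_of_props[OF S(1) GS(1)]
  have "fixed_ic A H C Gy ?S1 = spectrum_on (A + G ** C) (Q_of A H C Gy S) ?S1"
    using fixed_ic_eq[OF S1 G observable_zero[OF obs S1]] GS(2) by simp
  also have "\<dots> = spectrum_on (A + G ** C) (Q_of A H C Gy S) S + spectrum_on (A + G ** C) S ?S1"
    using Q(1,2) ic_friend_invariant[OF sub(2) G] ic_friend_invariant[OF sub(1) GS(1)] S(2) sub
    by (intro spectrum_on_add) (auto simp: invariant_subspace_iff)
  also have "spectrum_on (A + G ** C) (Q_of A H C Gy S) S = fixed_ic A H C Gy S"
    using fixed_ic_eq[OF S(1) GS(1) observable_zero[OF obs S(1,3)]] by simp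
  finally have "fixed_ic A H C Gy ?S1 = fixed_ic A H C Gy S + spectrum_on (A + G ** C) S ?S1" .
  with on show ?thesis
    using family_spectrum[OF S F G Fm(1) GS(1)] by (simp add: sigma_fixed_def)
qed

end

section \<open>Controllers\<close>

lemma matrix_inv:
  fixes M :: "'a::field^'n^'n"
  assumes "invertible M"
  shows "matrix_inv M ** M = mat 1" "M ** matrix_inv M = mat 1"
  using someI_ex[OF assms[unfolded invertible_def]] unfolding matrix_inv_def by auto

lemma matrix_inv_eqI:
  fixes M :: "'a::field^'n^'n"
  assumes "R ** M = mat 1"
  shows "invertible M" "matrix_inv M = R"
proof -
  show inv: "invertible M"
    using assms by (auto simp: invertible_left_inverse)
  have "R ** (M ** matrix_inv M) = matrix_inv M"
    by (simp add: matrix_mul_assoc assms)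
  then show "matrix_inv M = R"
    by (simp add: matrix_inv[OF inv])
qed

lemma mat_mult_vec: "mat l *v x = l *\<^sub>R (x :: real^'n)"
  by (simp add: vec_eq_iff matrix_vector_mult_def mat_def if_distrib[of "\<lambda>a. a * _"] cong: if_cong)

lemma cmatrix_mult: "cmatrix (M ** N) = cmatrix M ** cmatrix N"
  by (simp add: vec_eq_iff matrix_matrix_mult_def)

lemma cmatrix_add: "cmatrix (M + N) = cmatrix M + cmatrix N"
  by (simp add: vec_eq_iff)

lemma cmatrix_diff: "cmatrix (M - N) = cmatrix M - cmatrix N"
  by (simp add: vec_eq_iff)

lemma cmatrix_mat: "cmatrix (mat l) = mat (complex_of_real l)"
  by (simp add: vec_eq_iff mat_def)

lemma cmatrix_eq_0_iff: "cmatrix M = 0 \<longleftrightarrow> M = 0"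
  by (simp add: vec_eq_iff)

text \<open>
  For real \<open>l \<rightarrow> \<infinity>\<close> the resolvent \<open>R l\<close> tends to 0.  Hence \<open>G = 0\<close>, and
  \<open>{x. \<forall>l>b. C (R l x) = 0}\<close> is the required subspace by the resolvent identity \<open>R l A = l R l - I\<close>.
\<close>

lemma zero_transfer_invariant:
  fixes A :: "real^'n^'n" and H :: "real^'q^'n" and C :: "real^'n^'r" and G :: "real^'q^'r"
  assumes "zero_transfer A H C G"
  obtains U where "invariant_subspace A U" "\<And>w. H *v w \<in> U" "\<And>x. x \<in> U \<Longrightarrow> C *v x = 0"
    "\<And>w. G *v w = 0"
proof -
  obtain b where b: "b > 0" "\<And>x. norm (A *v x) \<le> norm x * b"
    using bounded_linear.pos_bounded[OF matrix_vector_mul_bounded_linear[of A]] by blast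
  define R where "R l = matrix_inv (mat l - A)" for l
  have shift: "(mat l - A) *v x = l *\<^sub>R x - A *v x" for l x
    by (simp add: matrix_vector_mult_diff_rdistrib mat_mult_vec)
  \<comment> \<open>For \<open>l > b\<close> the map \<open>l - A\<close> is bounded below, which
    yields both invertibility and the decay of \<open>R l\<close>.\<close>
  have coercive: "(l - b) * norm x \<le> norm (l *\<^sub>R x - A *v x)" if "l > b" for l x
    using norm_triangle_ineq2[of "l *\<^sub>R x" "A *v x"] b(2)[of x] that b(1)
    by (simp add: algebra_simps)
  have inv: "invertible (mat l - A)" if l: "l > b" for l
  proof -
    have "x = 0" if "(mat l - A) *v x = 0" for x
      using coercive[OF l, of x] that l by (simp add: shift mult_le_0_iff)
    then show ?thesis
      by (simp add: invertible_left_inverse matrix_left_invertible_ker)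
  qed
  have R_right: "l *\<^sub>R (R l *v x) - A *v (R l *v x) = x" if "l > b" for l x
    using matrix_inv(2)[OF inv[OF that]]
    by (metis R_def shift matrix_vector_mul_assoc matrix_vector_mul_lid)
  have R_left: "R l *v (A *v x) = l *\<^sub>R (R l *v x) - x" if "l > b" for l x
  proof -
    have "R l *v (l *\<^sub>R x - A *v x) = x"
      using matrix_inv(1)[OF inv[OF that]]
      by (metis R_def shift matrix_vector_mul_assoc matrix_vector_mul_lid)
    then show ?thesis
      by (simp add: matrix_vector_mult_diff_distrib matrix_vector_mult_scaleR algebra_simps)
  qed
  have lim_R: "((\<lambda>l. R l *v x) \<longlongrightarrow> 0) at_top" for x
  proof (rule Lim_null_comparison)
    show "\<forall>\<^sub>F l in at_top. norm (R l *v x) \<le> norm x / (l - b)"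
      using eventually_gt_at_top[of b]
    proof eventually_elim
      case (elim l)
      then show ?case
        using coercive[OF elim, of "R l *v x"] R_right[OF elim, of x] by (simp add: field_simps)
    qed
    show "((\<lambda>l. norm x / (l - b)) \<longlongrightarrow> 0) at_top"
      by real_asymp
  qed
  have lim: "((\<lambda>l. M *v (R l *v x)) \<longlongrightarrow> 0) at_top" for M :: "real^'n^'k" and x
    using bounded_linear.tendsto[OF matrix_vector_mul_bounded_linear lim_R, of M] by simp
  \<comment> \<open>Used with \<open>M = C\<close> to obtain \<open>G = 0\<close>, and with
    \<open>M = C ** A\<close> to place \<open>U\<close> in the kernel of \<open>C\<close>.\<close>
  have const: "y = 0" if "\<And>l. l > b \<Longrightarrow> M *v (R l *v x) = y"
    for M :: "real^'n^'k" and x y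
  proof -
    have "((\<lambda>l::real. y) \<longlongrightarrow> 0) at_top"
      using eventually_gt_at_top[of b] by (rule Lim_transform_eventually[OF lim[of M x] eventually_mono]) (rule that)
    then show ?thesis
      by (simp add: tendsto_const_iff)
  qed
  \<comment> \<open>The hypothesis concerns complex points; at real \<open>l\<close> the complex
    inverse is the complexification of \<open>R l\<close>.\<close>
  have transfer: "C *v (R l *v (H *v w)) + G *v w = 0" if l: "l > b" for l w
  proof -
    have "cmatrix (R l) ** (mat (complex_of_real l) - cmatrix A) = mat 1"
      using matrix_inv(1)[OF inv[OF l]]
      by (metis R_def cmatrix_diff cmatrix_mat cmatrix_mult of_real_1)
    from matrix_inv_eqI[OF this] assms
    have "cmatrix C ** cmatrix (R l) ** cmatrix H + cmatrix G = 0"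
      unfolding zero_transfer_def by metis
    then have "C ** R l ** H + G = 0"
      by (simp flip: cmatrix_mult cmatrix_add add: cmatrix_eq_0_iff)
    then show ?thesis
      by (metis matrix_vector_mul_assoc matrix_vector_mult_0 matrix_vector_mult_add_rdistrib)
  qed
  have G: "G *v w = 0" for w
    using const[of C "H *v w" "- (G *v w)"] transfer[of _ w] by (simp add: eq_neg_iff_add_eq_0)
  define U where "U = {x. \<forall>l>b. C *v (R l *v x) = 0}"
  have C: "C *v x = 0" if "x \<in> U" for x
  proof -
    have "(C ** A) *v (R l *v x) = - (C *v x)" if l: "l > b" for l
    proof -
      have "C *v (l *\<^sub>R (R l *v x) - A *v (R l *v x)) = C *v x"
        by (simp add: R_right[OF l])
      then have "- (C *v (A *v (R l *v x))) = C *v x"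
        using \<open>x \<in> U\<close> l by (simp add: U_def mat_simps matrix_vector_mult_scaleR)
      from this[symmetric] show ?thesis
        by (simp add: matrix_vector_mul_assoc matrix_mul_assoc)
    qed
    from const[OF this] show ?thesis
      by simp
  qed
  have "subspace U"
    by (simp add: U_def subspace_def matrix_vector_right_distrib matrix_vector_mult_scaleR)
  moreover have "A *v x \<in> U" if "x \<in> U" for x
    using that C[OF that] by (simp add: U_def R_left mat_simps matrix_vector_mult_scaleR)
  ultimately have "invariant_subspace A U"
    by (simp add: invariant_subspace_iff)
  moreover have "H *v w \<in> U" for w
    using transfer[of _ w] G[of w] by (simp add: U_def)
  ultimately show thesis
    using that C G by blast
qed

section \<open>From controllers to decoupling pairs\<close>

text \<open>Since \<open>W = 1 + D L W\<close>, a kernel vector \<open>x = - L W D x\<close> has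
  \<open>W D x = D x + D L W D x = 0\<close>, hence \<open>x = 0\<close>.\<close>

lemma invertible_feedback:
  fixes D :: "real^'m^'p" and L :: "real^'p^'m"
  assumes "invertible (mat 1 - D ** L)"
  shows "invertible (mat 1 + L ** matrix_inv (mat 1 - D ** L) ** D)"
proof -
  let ?W = "matrix_inv (mat 1 - D ** L)"
  have W: "?W *v v = v + D *v (L *v (?W *v v))" for v
  proof -
    have "(mat 1 - D ** L) *v (?W *v v) = v"
      by (simp add: matrix_vector_mul_assoc matrix_inv[OF assms])
    then show ?thesis
      by (simp add: mat_simps algebra_simps)
  qed
  have "x = 0" if "(mat 1 + L ** ?W ** D) *v x = 0" for x
  proof -
    have x: "x = - (L *v (?W *v (D *v x)))"
      using that by (simp add: mat_simps add_eq_0_iff2)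
    then have "D *v x = - (D *v (L *v (?W *v (D *v x))))"
      by (metis matrix_vector_mult_uminus_right)
    then have "D *v x + D *v (L *v (?W *v (D *v x))) = 0"
      by (simp only: eq_neg_iff_add_eq_0)
    then have "?W *v (D *v x) = 0"
      by (rule trans[OF W])
    then show ?thesis
      using x by simp
  qed
  then show ?thesis
    by (simp add: invertible_left_inverse matrix_left_invertible_ker)
qed

text \<open>Without a controller state, section and projection of \<open>U\<close> coincide, so
  \<open>U\<close> plays both roles.\<close>

lemma static_decoupling:
  assumes "static_solves_DDPDOF A B H C Dy Gy E Dz Gz Dc"
  shows "\<exists>K S0 V0. decoupling A B H C Dy Gy E Dz Gz K S0 V0"
proof -
  define K where "K = Dc ** matrix_inv (mat 1 - Dy ** Dc)"
  have "zero_transfer (A + B ** K ** C) (H + B ** K ** Gy) (E + Dz ** K ** C) (Gz + Dz ** K ** Gy)"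
    using assms by (simp add: static_solves_DDPDOF_def Let_def K_def matrix_mul_assoc)
  then obtain U where U: "invariant_subspace (A + B ** K ** C) U"
    "\<And>w. (H + B ** K ** Gy) *v w \<in> U" "\<And>x. x \<in> U \<Longrightarrow> (E + Dz ** K ** C) *v x = 0"
    "\<And>w. (Gz + Dz ** K ** Gy) *v w = 0"
    by (rule zero_transfer_invariant) (rule that)
  have sub: "subspace U"
    using U(1) by (simp add: invariant_subspace_iff)
  have loop: "A *v s + H *v w + B *v (K *v (C *v s + Gy *v w)) \<in> U"
    "E *v s + Gz *v w + Dz *v (K *v (C *v s + Gy *v w)) = 0" if s: "s \<in> U" for s w
  proof -
    have "A *v s + H *v w + B *v (K *v (C *v s + Gy *v w))
        = (A + B ** K ** C) *v s + (H + B ** K ** Gy) *v w"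
      "E *v s + Gz *v w + Dz *v (K *v (C *v s + Gy *v w))
        = (E + Dz ** K ** C) *v s + (Gz + Dz ** K ** Gy) *v w"
      by (simp_all add: mat_simps)
    then show "A *v s + H *v w + B *v (K *v (C *v s + Gy *v w)) \<in> U"
      "E *v s + Gz *v w + Dz *v (K *v (C *v s + Gy *v w)) = 0"
      using U s subspace_add[OF sub] by (simp_all add: invariant_subspace_iff)
  qed
  have "decoupling A B H C Dy Gy E Dz Gz K U U"
  proof
    have "invertible (mat 1 - Dy ** Dc)"
      using assms by (simp add: static_solves_DDPDOF_def)
    from invertible_feedback[OF this] show "invertible (mat 1 + K ** Dy)"
      by (simp add: K_def)
    show "output_nulling A B E Dz U"
      using loop[of _ 0] sub unfolding output_nulling_iff
      by (simp only: matrix_vector_mult_0_right add_0_right) blast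
    have "A *v s + H *v w \<in> U" if "s \<in> U" "C *v s + Gy *v w = 0" for s w
      using loop(1)[OF that(1), of w] that(2) by simp
    then show "input_containing A H C Gy U"
      using sub by (simp add: input_containing_iff)
  qed (use loop in auto)
  then show ?thesis
    by blast
qed

lemma dynamic_decoupling:
  fixes Ac :: "real^'s^'s"
  assumes "solves_DDPDOF A B H C Dy Gy E Dz Gz Ac Bc Cc Dc"
  shows "\<exists>K S0 V0. decoupling A B H C Dy Gy E Dz Gz K S0 V0"
proof -
  define W where "W = matrix_inv (mat 1 - Dy ** Dc)"
  define K where "K = Dc ** W"
  define Ah where "Ah = vstack
    (hstack (A + B ** Dc ** W ** C) (B ** Cc + B ** Dc ** W ** Dy ** Cc))
    (hstack (Bc ** W ** C) (Ac + Bc ** W ** Dy ** Cc))"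
  define Hh where "Hh = vstack (H + B ** Dc ** W ** Gy) (Bc ** W ** Gy)"
  define Ch where "Ch = hstack (E + Dz ** Dc ** W ** C) (Dz ** Cc + Dz ** Dc ** W ** Dy ** Cc)"
  have "zero_transfer Ah Hh Ch (Gz + Dz ** Dc ** W ** Gy)"
    using assms by (simp add: solves_DDPDOF_def Let_def Ah_def Hh_def Ch_def W_def)
  then obtain U where U: "invariant_subspace Ah U"
    "\<And>w. Hh *v w \<in> U" "\<And>x. x \<in> U \<Longrightarrow> Ch *v x = 0"
    "\<And>w. (Gz + Dz ** Dc ** W ** Gy) *v w = 0"
    by (rule zero_transfer_invariant) (rule that)
  have sub: "subspace U"
    using U(1) by (simp add: invariant_subspace_iff)
  \<comment> \<open>One closed-loop step, blockwise. At \<open>p = 0\<close> the plant part is that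
    of the static feedback \<open>K\<close>.\<close>
  have loop: "vstack (A *v x + H *v w + B *v (K *v (C *v x + Gy *v w) + Cc *v p + K *v (Dy *v (Cc *v p))))
      (Ac *v p + Bc *v (W *v (C *v x + Gy *v w + Dy *v (Cc *v p)))) \<in> U" (is "?x \<in> U")
    "E *v x + Gz *v w + Dz *v (K *v (C *v x + Gy *v w) + Cc *v p + K *v (Dy *v (Cc *v p))) = 0"
    (is "?z = 0") if xp: "vstack x p \<in> U" for x p w
  proof -
    have "?x = Ah *v vstack x p + Hh *v w"
      by (simp add: Ah_def Hh_def K_def vstack_add mat_simps algebra_simps)
    then show "?x \<in> U"
      using U(1,2) xp subspace_add[OF sub] by (simp add: invariant_subspace_iff)
    have "?z = Ch *v vstack x p + (Gz + Dz ** Dc ** W ** Gy) *v w"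
      by (simp add: Ch_def K_def mat_simps algebra_simps)
    then show "?z = 0"
      using U(3)[OF xp] U(4)[of w] by simp
  qed
  \<comment> \<open>\<open>S0\<close> is the section at controller state 0, and \<open>V0\<close> is
    the projection that forgets the controller state.\<close>
  define S0 where "S0 = {x. vstack x 0 \<in> U}"
  define V0 where "V0 = {x. \<exists>p. vstack x p \<in> U}"
  have "decoupling A B H C Dy Gy E Dz Gz K S0 V0"
  proof
    have "invertible (mat 1 - Dy ** Dc)"
      using assms by (simp add: solves_DDPDOF_def)
    from invertible_feedback[OF this] show "invertible (mat 1 + K ** Dy)"
      by (simp add: K_def W_def)
    show "S0 \<subseteq> V0"
      by (auto simp: S0_def V0_def)
    have "subspace V0"
      unfolding subspace_def V0_def
    proof (safe, goal_cases)
      case 1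
      show ?case
        using subspace_0[OF sub] by (intro exI[of _ 0]) simp
    next
      case (2 x y p q)
      then show ?case
        using subspace_add[OF sub, of "vstack x p" "vstack y q"]
        by (intro exI[of _ "p + q"]) (simp add: vstack_add)
    next
      case (3 c x p)
      then show ?case
        using subspace_scale[OF sub, of "vstack x p" c]
        by (intro exI[of _ "c *\<^sub>R p"]) (simp add: vstack_scaleR)
    qed
    moreover have "\<exists>u. A *v x + B *v u \<in> V0 \<and> E *v x + Dz *v u = 0" if "x \<in> V0" for x
    proof -
      from that obtain p where "vstack x p \<in> U"
        by (auto simp: V0_def)
      from loop[OF this, of 0] show ?thesis
        unfolding V0_def by auto
    qed
    ultimately show "output_nulling A B E Dz V0"
      by (simp add: output_nulling_iff)
    have "subspace S0"
      unfolding subspace_def S0_def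
    proof (safe, goal_cases)
      case 1
      show ?case
        using subspace_0[OF sub] by simp
    next
      case (2 x y)
      then show ?case
        using subspace_add[OF sub, of "vstack x 0" "vstack y 0"] by (simp add: vstack_add)
    next
      case (3 c x)
      then show ?case
        using subspace_scale[OF sub, of "vstack x 0" c] by (simp add: vstack_scaleR)
    qed
    \<comment> \<open>From controller state 0 and with \<open>C *v s + Gy *v w = 0\<close>, the
      controller state stays 0, so the successor remains in the section.\<close>
    moreover have "A *v s + H *v w \<in> S0" if "s \<in> S0" "C *v s + Gy *v w = 0" for s w
      using loop(1)[of s 0 w] that by (simp add: S0_def)
    ultimately show "input_containing A H C Gy S0"
      by (simp add: input_containing_iff)
    show "A *v s + H *v w + B *v (K *v (C *v s + Gy *v w)) \<in> V0 \<and>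
      E *v s + Gz *v w + Dz *v (K *v (C *v s + Gy *v w)) = 0" if "s \<in> S0" for s w
      using loop[of s 0 w] that by (auto simp: S0_def V0_def)
  qed
  then show ?thesis
    by blast
qed

lemma DDPDOF_decoupling:
  assumes "DDPDOF_solvable TYPE('s::finite) A B H C Dy Gy E Dz Gz"
  obtains K S0 V0 where "decoupling A B H C Dy Gy E Dz Gz K S0 V0"
  using assms static_decoupling dynamic_decoupling unfolding DDPDOF_solvable_def by metis

theorem lemma9:
  fixes A :: "real^'n^'n" and B :: "real^'m^'n" and H :: "real^'q^'n"
    and C :: "real^'n^'p" and Dy :: "real^'m^'p" and Gy :: "real^'q^'p"
    and E :: "real^'n^'r" and Dz :: "real^'m^'r" and Gz :: "real^'q^'r"
  assumes "DDPDOF_solvable TYPE('s::finite) A B H C Dy Gy E Dz Gz"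
    and "reachable A (hstack B H)"
    and "observable (vstack C E) A"
  shows "\<exists>K :: real^'p^'m. \<forall>S.
    input_containing A H C Gy S \<and>
    V_m A B H E Dz Gz \<inter> S_M A H C Gy E Gz \<subseteq> S \<and> S \<subseteq> S_M A H C Gy E Gz \<longrightarrow>
    solution_triple A B H C Dy Gy E Dz Gz S (S + V_m A B H E Dz Gz) K \<and>
    sigma_fixed A B H C Gy E Dz S (S + V_m A B H E Dz Gz) =
      sigma_fixed A B H C Gy E Dz
        (V_m A B H E Dz Gz \<inter> S_M A H C Gy E Gz) (V_m A B H E Dz Gz)"
proof -
  obtain K S0 V0 where "decoupling A B H C Dy Gy E Dz Gz K S0 V0"
    using DDPDOF_decoupling[OF assms(1)] .
  \<comment> \<open>\<open>K\<close> is fixed here before any \<open>S\<close> is considered, as the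
    order of quantifiers demands.\<close>
  then interpret decoupling A B H C Dy Gy E Dz Gz K S0 V0 .
  show ?thesis
    using family_solution_triple family_sigma_fixed[OF assms(2,3)] by blast
qed

end
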